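(* Let $P=(P(i,j))_{(i,j)\in\mathbb{N}^2}$ be an irreducible and aperiodic Markov kernel on $\mathbb{N}$ with a unique invariant probability measure $\pi=(\pi(i))_{i\in\mathbb{N}}$, and suppose that there exist $i_0\in\mathbb{N}$ and $N\in\mathbb{N}$, $N\ge 1$, such that for all $i\ge i_0$ and all $j\in\mathbb{N}$, $|i-j|>N$ implies $P(i,j)=0$. Assume that $$\alpha_0 := \sum_{m=-N}^{N}\ \limsup_{i\to+\infty}\sqrt{P(i,i+m)\,P^*(i+m,i)}\ <\ 1 .$$ Then $P$ has the spectral gap property on $\ell^2(\pi)$: there exist $\rho\in(0,1)$ and $C\in(0,+\infty)$ such that $$\forall n\ge 1,\ \forall f\in\ell^2(\pi),\qquad \|P^nf-\Pi f\|_2\le C\,\rho^n\,\|f\|_2 .$$ Moreover $r_{ess}(P_{|\ell^2(\pi)})\le\alpha_0$.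
   Context: $\mathbb{N}=\{0,1,2,\ldots\}$. $\ell^2(\pi)$ is the Hilbert space of complex sequences $f=(f(i))_{i\in\mathbb{N}}$ with $\|f\|_2:=\big(\sum_{i\ge0}|f(i)|^2\pi(i)\big)^{1/2}<\infty$. $P$ acts by $(Pf)(i)=\sum_{j}P(i,j)f(j)$ and is a linear contraction on $\ell^2(\pi)$; $P_{|\ell^2(\pi)}$ denotes this operator. Its adjoint on $\ell^2(\pi)$ is given by $P^*(i,j):=\pi(j)P(j,i)/\pi(i)$. $\Pi f:=\pi(f)1_{\mathbb{N}}$, where $\pi(f):=\sum_{i\ge0}f(i)\pi(i)$ and $1_{\mathbb{N}}$ is the constant sequence $1$. For a bounded linear operator $T$ on a complex Banach space, $r_{ess}(T)$ denotes its essential spectral radius, i.e. the infimum of the $r\ge0$ such that every spectral value $\lambda$ of $T$ with $|\lambda|>r$ is an isolated point of the spectrum and an eigenvalue of finite algebraic multiplicity. *)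

theory Defs
  imports "HOL-Complex_Analysis.Complex_Analysis"
begin

section \<open>Markov kernels on the natural numbers\<close>

definition markov_kernel :: "(nat \<Rightarrow> nat \<Rightarrow> real) \<Rightarrow> bool" where
  "markov_kernel P \<longleftrightarrow> (\<forall>i j. 0 \<le> P i j) \<and> (\<forall>i. P i sums 1)"

primrec kernel_power :: "(nat \<Rightarrow> nat \<Rightarrow> real) \<Rightarrow> nat \<Rightarrow> nat \<Rightarrow> nat \<Rightarrow> real" where
  "kernel_power P 0 = (\<lambda>i j. if i = j then 1 else 0)"
| "kernel_power P (Suc n) = (\<lambda>i j. \<Sum>k. P i k * kernel_power P n k j)"

definition irreducible_kernel :: "(nat \<Rightarrow> nat \<Rightarrow> real) \<Rightarrow> bool" where
  "irreducible_kernel P \<longleftrightarrow> (\<forall>i j. \<exists>n. kernel_power P n i j > 0)"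

definition aperiodic_kernel :: "(nat \<Rightarrow> nat \<Rightarrow> real) \<Rightarrow> bool" where
  "aperiodic_kernel P \<longleftrightarrow> (\<forall>i. Gcd {n. 1 \<le> n \<and> kernel_power P n i i > 0} = 1)"

definition invariant_probability :: "(nat \<Rightarrow> nat \<Rightarrow> real) \<Rightarrow> (nat \<Rightarrow> real) \<Rightarrow> bool" where
  "invariant_probability P \<pi> \<longleftrightarrow>
     (\<forall>i. 0 \<le> \<pi> i) \<and> \<pi> sums 1 \<and> (\<forall>j. (\<lambda>i. \<pi> i * P i j) sums \<pi> j)"

definition adjoint_kernel :: "(nat \<Rightarrow> real) \<Rightarrow> (nat \<Rightarrow> nat \<Rightarrow> real) \<Rightarrow> nat \<Rightarrow> nat \<Rightarrow> real" where
  "adjoint_kernel \<pi> P i j = \<pi> j * P j i / \<pi> i"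

text \<open>For i \<open>\<ge>\<close> N the index i + m is a natural number for every m in the sum; the truncation
  by \<^const>\<open>nat\<close> affects finitely many i only and hence not the limits superior.\<close>

definition alpha0 :: "(nat \<Rightarrow> real) \<Rightarrow> (nat \<Rightarrow> nat \<Rightarrow> real) \<Rightarrow> nat \<Rightarrow> ereal" where
  "alpha0 \<pi> P N =
     (\<Sum>m\<in>{- int N..int N}. limsup (\<lambda>i. ereal (sqrt
        (P i (nat (int i + m)) * adjoint_kernel \<pi> P (nat (int i + m)) i))))"


section \<open>The Hilbert space of square-summable sequences and the action of a kernel\<close>

definition l2 :: "(nat \<Rightarrow> real) \<Rightarrow> (nat \<Rightarrow> complex) set" where
  "l2 \<pi> = {f. summable (\<lambda>i. (cmod (f i))\<^sup>2 * \<pi> i)}"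

definition l2norm :: "(nat \<Rightarrow> real) \<Rightarrow> (nat \<Rightarrow> complex) \<Rightarrow> real" where
  "l2norm \<pi> f = sqrt (\<Sum>i. (cmod (f i))\<^sup>2 * \<pi> i)"

definition kernel_op :: "(nat \<Rightarrow> nat \<Rightarrow> real) \<Rightarrow> (nat \<Rightarrow> complex) \<Rightarrow> (nat \<Rightarrow> complex)" where
  "kernel_op P f = (\<lambda>i. \<Sum>j. complex_of_real (P i j) * f j)"

definition mean_op :: "(nat \<Rightarrow> real) \<Rightarrow> (nat \<Rightarrow> complex) \<Rightarrow> (nat \<Rightarrow> complex)" where
  "mean_op \<pi> f = (\<lambda>_. \<Sum>i. f i * complex_of_real (\<pi> i))"

text \<open>The function \<^const>\<open>l2norm\<close> is meaningful only on \<^const>\<open>l2\<close>, so the estimate includes that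
  the difference belongs to the space.\<close>

definition spectral_gap :: "(nat \<Rightarrow> real) \<Rightarrow> (nat \<Rightarrow> nat \<Rightarrow> real) \<Rightarrow> bool" where
  "spectral_gap \<pi> P \<longleftrightarrow>
     (\<exists>\<rho> C :: real. 0 < \<rho> \<and> \<rho> < 1 \<and> 0 < C \<and>
        (\<forall>n\<ge>1. \<forall>f\<in>l2 \<pi>.
           (\<lambda>i. (kernel_op P ^^ n) f i - mean_op \<pi> f i) \<in> l2 \<pi> \<and>
           l2norm \<pi> (\<lambda>i. (kernel_op P ^^ n) f i - mean_op \<pi> f i) \<le> C * \<rho> ^ n * l2norm \<pi> f))"


section \<open>Spectral theory on this space\<close>

text \<open>An operator is a function on all sequences; only its restriction to \<^term>\<open>l2 \<pi>\<close> matters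
  in the definitions below.\<close>

definition bounded_op :: "(nat \<Rightarrow> real) \<Rightarrow> ((nat \<Rightarrow> complex) \<Rightarrow> (nat \<Rightarrow> complex)) \<Rightarrow> bool" where
  "bounded_op \<pi> T \<longleftrightarrow>
     (\<forall>f\<in>l2 \<pi>. T f \<in> l2 \<pi>) \<and>
     (\<forall>f\<in>l2 \<pi>. \<forall>g\<in>l2 \<pi>. T (\<lambda>i. f i + g i) = (\<lambda>i. T f i + T g i)) \<and>
     (\<forall>c. \<forall>f\<in>l2 \<pi>. T (\<lambda>i. c * f i) = (\<lambda>i. c * T f i)) \<and>
     (\<exists>K. \<forall>f\<in>l2 \<pi>. l2norm \<pi> (T f) \<le> K * l2norm \<pi> f)"

definition resolvent_set ::
  "(nat \<Rightarrow> real) \<Rightarrow> ((nat \<Rightarrow> complex) \<Rightarrow> (nat \<Rightarrow> complex)) \<Rightarrow> complex set" where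
  "resolvent_set \<pi> T =
     {z. \<exists>S. bounded_op \<pi> S \<and>
         (\<forall>f\<in>l2 \<pi>. S (\<lambda>i. z * f i - T f i) = f \<and> (\<lambda>i. z * S f i - T (S f) i) = f)}"

definition spectrum ::
  "(nat \<Rightarrow> real) \<Rightarrow> ((nat \<Rightarrow> complex) \<Rightarrow> (nat \<Rightarrow> complex)) \<Rightarrow> complex set" where
  "spectrum \<pi> T = - resolvent_set \<pi> T"

definition eigenvalue ::
  "(nat \<Rightarrow> real) \<Rightarrow> ((nat \<Rightarrow> complex) \<Rightarrow> (nat \<Rightarrow> complex)) \<Rightarrow> complex \<Rightarrow> bool" where
  "eigenvalue \<pi> T z \<longleftrightarrow> (\<exists>f\<in>l2 \<pi>. f \<noteq> (\<lambda>_. 0) \<and> T f = (\<lambda>i. z * f i))"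

definition resolvent ::
  "(nat \<Rightarrow> real) \<Rightarrow> ((nat \<Rightarrow> complex) \<Rightarrow> (nat \<Rightarrow> complex)) \<Rightarrow> complex \<Rightarrow>
     (nat \<Rightarrow> complex) \<Rightarrow> (nat \<Rightarrow> complex)" where
  "resolvent \<pi> T z f = (THE g. g \<in> l2 \<pi> \<and> (\<lambda>i. z * g i - T g i) = f)"

text \<open>The algebraic multiplicity of an isolated spectral value is the rank of its Riesz projection
  \<open>1/(2\<pi>i) \<integral> (w - T)\<^sup>-\<^sup>1 dw\<close>. (In infinite dimension, the span of the kernels of the powers of
  \<open>z - T\<close> may be strictly smaller than its range.) The integral is computed coordinatewise: if all
  weights are positive, as for the invariant probability of an irreducible kernel, then the
  coordinate evaluations are continuous and commute with the operator-valued integral. The range of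
  the projection does not depend on the radius \<open>e\<close>, provided that the closed disc meets the spectrum
  in its centre only.\<close>

definition riesz_projection ::
  "(nat \<Rightarrow> real) \<Rightarrow> ((nat \<Rightarrow> complex) \<Rightarrow> (nat \<Rightarrow> complex)) \<Rightarrow> complex \<Rightarrow> real \<Rightarrow>
     (nat \<Rightarrow> complex) \<Rightarrow> (nat \<Rightarrow> complex)" where
  "riesz_projection \<pi> T z e f =
     (\<lambda>i. 1 / (2 * complex_of_real pi * \<i>) *
            contour_integral (circlepath z e) (\<lambda>w. resolvent \<pi> T w f i))"

definition finite_dimensional :: "(nat \<Rightarrow> complex) set \<Rightarrow> bool" where
  "finite_dimensional V \<longleftrightarrow>
     (\<exists>B. finite B \<and> (\<forall>g\<in>V. \<exists>c. g = (\<lambda>i. \<Sum>b\<in>B. c b * b i)))"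

definition finite_algebraic_multiplicity ::
  "(nat \<Rightarrow> real) \<Rightarrow> ((nat \<Rightarrow> complex) \<Rightarrow> (nat \<Rightarrow> complex)) \<Rightarrow> complex \<Rightarrow> bool" where
  "finite_algebraic_multiplicity \<pi> T z \<longleftrightarrow>
     (\<exists>e>0. spectrum \<pi> T \<inter> cball z e = {z} \<and>
            finite_dimensional (riesz_projection \<pi> T z e ` l2 \<pi>))"

definition ess_spectral_radius ::
  "(nat \<Rightarrow> real) \<Rightarrow> ((nat \<Rightarrow> complex) \<Rightarrow> (nat \<Rightarrow> complex)) \<Rightarrow> ereal" where
  "ess_spectral_radius \<pi> T =
     Inf {ereal r | r. 0 \<le> r \<and>
            (\<forall>z\<in>spectrum \<pi> T. r < cmod z \<longrightarrow>
               z isolated_in spectrum \<pi> T \<and> eigenvalue \<pi> T z \<and>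
               finite_algebraic_multiplicity \<pi> T z)}"

end

theory Submission
  imports Defs "Jordan_Normal_Form.Determinant" "HOL-Computational_Algebra.Group_Closure"
begin

text \<open>
  Split the kernel by rows: \<open>P = T + H\<close>, where \<open>H\<close> keeps the rows below some index \<open>M\<close> and \<open>T\<close> the
  rows from \<open>M\<close> on. The range of \<open>H\<close> lies in the span of the first \<open>M\<close> coordinate sequences. If \<open>M\<close>
  is large, then \<open>T\<close> is a sum of \<open>2 N + 1\<close> weighted shifts. After the change of variables
  \<open>f(i) \<mapsto> f(i) sqrt(\<pi>(i))\<close>, the entry of \<open>T\<close> at \<open>(i, i + m)\<close> is
  \<open>sqrt(P(i, i + m) P\<^sup>*(i + m, i))\<close>, so a shift has as its norm the supremum of these entries over
  \<open>i \<ge> M\<close>. Hence the norm of \<open>T\<close> is at most \<open>a\<close>, for every \<open>a > \<alpha>\<^sub>0\<close> and a suitable \<open>M\<close>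
  (\<open>diagonal_bounds_if_alpha0_less\<close>, \<open>tail_norm_le_sum_of_diagonals\<close>). Both conclusions rest
  on this splitting.

  Spectral gap. For \<open>a < 1\<close> let \<open>d\<^sub>n\<close> be a bound for the norm of \<open>P\<^sup>n - \<Pi>\<close>. Since
  \<open>P\<^sup>n\<^sup>+\<^sup>1 - \<Pi> = (P\<^sup>n - \<Pi>) (T + H)\<close>, one may take \<open>d\<^sub>n\<^sub>+\<^sub>1 = a d\<^sub>n + \<epsilon>\<^sub>n\<close>, where \<open>\<epsilon>\<^sub>n\<close> bounds
  the norm of \<open>(P\<^sup>n - \<Pi>) H\<close>. So \<open>d\<^sub>n \<rightarrow> 0\<close> follows as soon as \<open>P\<^sup>n f \<rightarrow> \<Pi> f\<close> for the finitely many
  coordinate sequences \<open>f\<close>, and then the decay is geometric because \<open>P\<^sup>m\<^sup>+\<^sup>n - \<Pi> = (P\<^sup>m - \<Pi>) (P\<^sup>n - \<Pi>)\<close>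
  (\<open>spectral_gap_if_tail_contraction\<close>). The convergence on bounded \<open>f\<close> (\<open>iterates_converge_to_mean\<close>)
  is a compactness argument: along a subsequence the iterates of \<open>f - \<Pi> f\<close> converge at every state,
  hence in norm, as \<open>\<pi>\<close> is finite. On the orbit of the limit \<open>g\<close> the contraction \<open>P\<close> is isometric.
  The loss of squared norm under \<open>P\<close> is the mean of the variances of the sequence under the rows of \<open>P\<close>, so
  \<open>g\<close> takes equal values at the ends of two paths of equal length with a common start. By
  irreducibility and aperiodicity any two states are such ends (\<open>equal_length_paths\<close>), so \<open>g\<close> is
  constant, and its mean is \<open>0\<close>.

  Essential spectral radius. For \<open>|z| > a\<close> the Neumann series gives \<open>R(z) = (z - T)\<^sup>-\<^sup>1\<close>, and
  \<open>z f - P f = g\<close> is equivalent to \<open>f = R(z) (g + H f)\<close>. The \<open>M\<close> coordinates of \<open>H f\<close> solve a linear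
  system whose matrix is holomorphic in \<open>z\<close>. The zeros of its determinant are the spectral values
  outside the disc of radius \<open>a\<close>, and all of them are eigenvalues. The determinant is not identically
  zero because \<open>P\<close> is bounded, so its zeros are isolated. By Cramer's rule the resolvent of \<open>P\<close> has a
  pole at such a zero, and its principal part takes values in the span of the finitely many
  derivatives of \<open>R(z) e\<^sub>j\<close>, \<open>j < M\<close>. This span contains the range of the Riesz projection
  (\<open>spectral_value_outside_disc\<close>).
\<close>

section \<open>Weighted square-summable sequences\<close>

locale positive_weight =
  fixes \<pi> :: "nat \<Rightarrow> real"
  assumes weight_pos: "0 < \<pi> i"
begin

lemma weight_nonneg [simp]: "0 \<le> \<pi> i"
  using weight_pos[of i] by simp

text \<open>The norm of the restriction to the first \<open>n\<close> coordinates. Bounds for all \<open>n\<close> give membership in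
  the space and a bound for the norm at once, so that finite-dimensional inequalities carry over.\<close>

definition section_norm :: "nat \<Rightarrow> (nat \<Rightarrow> complex) \<Rightarrow> real" where
  "section_norm n f = L2_set (\<lambda>i. cmod (f i) * sqrt (\<pi> i)) {..<n}"

lemma section_norm_sq: "(section_norm n f)\<^sup>2 = (\<Sum>i<n. (cmod (f i))\<^sup>2 * \<pi> i)"
  by (simp add: section_norm_def L2_set_def sum_nonneg power_mult_distrib)

lemma section_norm_nonneg [simp]: "0 \<le> section_norm n f"
  by (simp add: section_norm_def L2_set_nonneg)

lemma section_norm_le: "f \<in> l2 \<pi> \<Longrightarrow> section_norm n f \<le> l2norm \<pi> f"
  unfolding l2norm_def
  by (intro real_le_rsqrt, unfold section_norm_sq) (auto simp: l2_def intro!: sum_le_suminf)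

lemma l2norm_nonneg [simp]: "f \<in> l2 \<pi> \<Longrightarrow> 0 \<le> l2norm \<pi> f"
  using section_norm_le[of f 0] section_norm_nonneg[of 0 f] by linarith

lemma
  assumes "\<And>n. section_norm n f \<le> B"
  shows l2_if_sections_bounded: "f \<in> l2 \<pi>"
    and l2norm_le_if_sections_bounded: "l2norm \<pi> f \<le> B"
proof -
  have B: "0 \<le> B"
    using assms[of 0] section_norm_nonneg[of 0 f] by linarith
  have *: "(\<Sum>i<n. (cmod (f i))\<^sup>2 * \<pi> i) \<le> B\<^sup>2" for n
    using power_mono[OF assms[of n] section_norm_nonneg, of 2] by (simp add: section_norm_sq)
  have s: "summable (\<lambda>i. (cmod (f i))\<^sup>2 * \<pi> i)"
    by (rule summableI_nonneg_bounded[of _ "B\<^sup>2"]) (use * in auto)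
  then show "f \<in> l2 \<pi>" by (simp add: l2_def)
  have "(\<Sum>i. (cmod (f i))\<^sup>2 * \<pi> i) \<le> B\<^sup>2"
    by (rule suminf_le_const[OF s]) (use * in auto)
  then show "l2norm \<pi> f \<le> B"
    unfolding l2norm_def using B by (simp add: real_le_lsqrt)
qed

lemma section_norm_triangle: "section_norm n (\<lambda>i. f i + g i) \<le> section_norm n f + section_norm n g"
proof -
  have "section_norm n (\<lambda>i. f i + g i)
      \<le> L2_set (\<lambda>i. cmod (f i) * sqrt (\<pi> i) + cmod (g i) * sqrt (\<pi> i)) {..<n}"
    unfolding section_norm_def
    by (rule L2_set_mono) (auto simp: norm_triangle_ineq mult_right_mono simp flip: distrib_right)
  also have "\<dots> \<le> section_norm n f + section_norm n g"
    unfolding section_norm_def by (rule L2_set_triangle_ineq)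
  finally show ?thesis .
qed

lemma
  assumes "f \<in> l2 \<pi>" "g \<in> l2 \<pi>"
  shows l2_add: "(\<lambda>i. f i + g i) \<in> l2 \<pi>"
    and l2norm_triangle: "l2norm \<pi> (\<lambda>i. f i + g i) \<le> l2norm \<pi> f + l2norm \<pi> g"
proof -
  have *: "section_norm n (\<lambda>i. f i + g i) \<le> l2norm \<pi> f + l2norm \<pi> g" for n
    using section_norm_triangle[of n f g] section_norm_le[OF assms(1), of n]
      section_norm_le[OF assms(2), of n] by linarith
  show "(\<lambda>i. f i + g i) \<in> l2 \<pi>" by (rule l2_if_sections_bounded[OF *])
  show "l2norm \<pi> (\<lambda>i. f i + g i) \<le> l2norm \<pi> f + l2norm \<pi> g"
    by (rule l2norm_le_if_sections_bounded[OF *])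
qed

lemma
  assumes "f \<in> l2 \<pi>"
  shows l2_scale: "(\<lambda>i. c * f i) \<in> l2 \<pi>"
    and l2norm_scale: "l2norm \<pi> (\<lambda>i. c * f i) = cmod c * l2norm \<pi> f"
proof -
  have *: "(\<lambda>i. (cmod (c * f i))\<^sup>2 * \<pi> i) = (\<lambda>i. (cmod c)\<^sup>2 * ((cmod (f i))\<^sup>2 * \<pi> i))"
    by (simp add: norm_mult power_mult_distrib mult.assoc)
  show "(\<lambda>i. c * f i) \<in> l2 \<pi>" using assms by (auto simp: l2_def * intro: summable_mult)
  show "l2norm \<pi> (\<lambda>i. c * f i) = cmod c * l2norm \<pi> f"
    using assms unfolding l2norm_def *
    by (subst suminf_mult) (auto simp: l2_def real_sqrt_mult)
qed

lemma l2_zero [simp]: "(\<lambda>i. 0) \<in> l2 \<pi>"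
  and l2norm_zero [simp]: "l2norm \<pi> (\<lambda>i. 0) = 0"
  by (simp_all add: l2_def l2norm_def)

lemma l2_minus: "f \<in> l2 \<pi> \<Longrightarrow> (\<lambda>i. - f i) \<in> l2 \<pi>"
  using l2_scale[of f "-1"] by simp

lemma l2norm_minus: "l2norm \<pi> (\<lambda>i. - f i) = l2norm \<pi> f"
  by (simp add: l2norm_def)

lemma
  assumes "f \<in> l2 \<pi>" "g \<in> l2 \<pi>"
  shows l2_diff: "(\<lambda>i. f i - g i) \<in> l2 \<pi>"
    and l2norm_triangle_diff: "l2norm \<pi> (\<lambda>i. f i - g i) \<le> l2norm \<pi> f + l2norm \<pi> g"
  using l2_add[OF assms(1) l2_minus[OF assms(2)]] l2norm_triangle[OF assms(1) l2_minus[OF assms(2)]]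
  by (simp_all add: l2norm_minus)

lemma
  assumes "finite X" "\<And>x. x \<in> X \<Longrightarrow> F x \<in> l2 \<pi>"
  shows l2_sum: "(\<lambda>i. \<Sum>x\<in>X. F x i) \<in> l2 \<pi>"
    and l2norm_sum: "l2norm \<pi> (\<lambda>i. \<Sum>x\<in>X. F x i) \<le> (\<Sum>x\<in>X. l2norm \<pi> (F x))"
proof -
  have "(\<lambda>i. \<Sum>x\<in>X. F x i) \<in> l2 \<pi> \<and> l2norm \<pi> (\<lambda>i. \<Sum>x\<in>X. F x i) \<le> (\<Sum>x\<in>X. l2norm \<pi> (F x))"
    using assms
  proof (induction X)
    case (insert x X)
    then show ?case
      using l2_add[of "F x" "\<lambda>i. \<Sum>x\<in>X. F x i"] l2norm_triangle[of "F x" "\<lambda>i. \<Sum>x\<in>X. F x i"]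
      by simp
  qed auto
  then show "(\<lambda>i. \<Sum>x\<in>X. F x i) \<in> l2 \<pi>"
    "l2norm \<pi> (\<lambda>i. \<Sum>x\<in>X. F x i) \<le> (\<Sum>x\<in>X. l2norm \<pi> (F x))" by blast+
qed

lemma coordinate_le_l2norm:
  assumes "f \<in> l2 \<pi>"
  shows "cmod (f i) \<le> l2norm \<pi> f / sqrt (\<pi> i)"
proof -
  have "cmod (f i) * sqrt (\<pi> i) \<le> section_norm (Suc i) f"
    unfolding section_norm_def by (rule member_le_L2_set) auto
  also have "\<dots> \<le> l2norm \<pi> f" by (rule section_norm_le[OF assms])
  finally show ?thesis using weight_pos[of i] by (simp add: pos_le_divide_eq)
qed

lemma l2norm_eq_0D:
  assumes "f \<in> l2 \<pi>" "l2norm \<pi> f \<le> 0"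
  shows "f = (\<lambda>i. 0)"
proof
  fix i
  have "l2norm \<pi> f = 0" using assms(2) l2norm_nonneg[OF assms(1)] by linarith
  then show "f i = 0" using coordinate_le_l2norm[OF assms(1), of i] by simp
qed

text \<open>Fatou's lemma for sequences: balls are closed under coordinatewise limits.\<close>

lemma
  assumes "\<And>k. F k \<in> l2 \<pi>" "\<And>k. l2norm \<pi> (F k) \<le> B" "\<And>i. (\<lambda>k. F k i) \<longlonglongrightarrow> f i"
  shows l2_pointwise_limit: "f \<in> l2 \<pi>"
    and l2norm_pointwise_limit: "l2norm \<pi> f \<le> B"
proof -
  have *: "section_norm n f \<le> B" for n
  proof (rule LIMSEQ_le_const2)
    show "(\<lambda>k. section_norm n (F k)) \<longlonglongrightarrow> section_norm n f"
      unfolding section_norm_def L2_set_def by (intro tendsto_intros assms(3))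
    show "\<exists>N. \<forall>k\<ge>N. section_norm n (F k) \<le> B"
      using section_norm_le[OF assms(1)] assms(2) order_trans by blast
  qed
  show "f \<in> l2 \<pi>" by (rule l2_if_sections_bounded[OF *])
  show "l2norm \<pi> f \<le> B" by (rule l2norm_le_if_sections_bounded[OF *])
qed

lemma l2_eventually_zero: "(\<And>i. i \<ge> n \<Longrightarrow> f i = 0) \<Longrightarrow> f \<in> l2 \<pi>"
  unfolding l2_def by (auto intro!: summable_finite[of "{..<n}"]) (metis not_less)

lemma l2_mono:
  assumes "f \<in> l2 \<pi>" "\<And>i. cmod (g i) \<le> cmod (f i)"
  shows "g \<in> l2 \<pi>"
proof -
  have *: "section_norm n g \<le> l2norm \<pi> f" for n
  proof -
    have "section_norm n g \<le> section_norm n f"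
      unfolding section_norm_def by (rule L2_set_mono) (auto intro: mult_right_mono assms(2))
    then show ?thesis using section_norm_le[OF assms(1), of n] by linarith
  qed
  show ?thesis by (rule l2_if_sections_bounded[OF *])
qed

text \<open>Completeness, in the form that the Neumann series requires: an absolutely convergent series has a
  sum in the space, which is its coordinatewise sum, and its tails are small in norm.\<close>

lemma
  fixes F :: "nat \<Rightarrow> nat \<Rightarrow> complex"
  assumes F: "\<And>k. F k \<in> l2 \<pi>" and Fb: "\<And>k. l2norm \<pi> (F k) \<le> b k" and b: "summable b"
  shows l2_suminf: "(\<lambda>i. \<Sum>k. F k i) \<in> l2 \<pi>"
    and l2norm_suminf_tail: "l2norm \<pi> (\<lambda>i. (\<Sum>k. F k i) - (\<Sum>k<n. F k i)) \<le> (\<Sum>k. b (k + n))"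
proof -
  have b0: "0 \<le> b k" for k
    using Fb[of k] l2norm_nonneg[OF F[of k]] by linarith
  have sumF: "summable (\<lambda>k. F k i)" for i
  proof (rule summable_comparison_test')
    show "summable (\<lambda>k. b k / sqrt (\<pi> i))" by (intro summable_divide b)
    show "norm (F k i) \<le> b k / sqrt (\<pi> i)" if "k \<ge> 0" for k
      using coordinate_le_l2norm[OF F[of k], of i]
        divide_right_mono[OF Fb[of k], of "sqrt (\<pi> i)"] by simp
  qed
  have part: "l2norm \<pi> (\<lambda>i. \<Sum>k<m. F (k + n) i) \<le> (\<Sum>k. b (k + n))" for m n
  proof -
    have "l2norm \<pi> (\<lambda>i. \<Sum>k<m. F (k + n) i) \<le> (\<Sum>k<m. l2norm \<pi> (F (k + n)))"
      by (rule l2norm_sum) (auto intro: F)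
    also have "\<dots> \<le> (\<Sum>k<m. b (k + n))" by (intro sum_mono Fb)
    also have "\<dots> \<le> (\<Sum>k. b (k + n))"
      by (rule sum_le_suminf) (use b b0 in auto)
    finally show ?thesis .
  qed
  have lim: "(\<lambda>m. \<Sum>k<m. F (k + n) i) \<longlonglongrightarrow> (\<Sum>k. F k i) - (\<Sum>k<n. F k i)" for n i
  proof -
    have "(\<lambda>k. F (k + n) i) sums ((\<Sum>k. F k i) - (\<Sum>k<n. F k i))"
      by (rule sums_split_initial_segment[OF summable_sums[OF sumF]])
    then show ?thesis by (simp add: sums_def)
  qed
  have inl2: "(\<lambda>i. \<Sum>k<m. F (k + n) i) \<in> l2 \<pi>" for m n
    by (rule l2_sum) (auto intro: F)
  show "l2norm \<pi> (\<lambda>i. (\<Sum>k. F k i) - (\<Sum>k<n. F k i)) \<le> (\<Sum>k. b (k + n))" for n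
    by (rule l2norm_pointwise_limit[OF inl2 part lim])
  show "(\<lambda>i. \<Sum>k. F k i) \<in> l2 \<pi>"
    using l2_pointwise_limit[OF inl2[where n = 0] part[where n = 0] lim[where n = 0]] by simp
qed

lemma l2norm_reverse_triangle:
  assumes "f \<in> l2 \<pi>" "g \<in> l2 \<pi>"
  shows "\<bar>l2norm \<pi> f - l2norm \<pi> g\<bar> \<le> l2norm \<pi> (\<lambda>i. f i - g i)"
  using l2norm_triangle[OF l2_diff[OF assms] assms(2)] l2norm_triangle[OF l2_diff[OF assms(2,1)] assms(1)]
    l2norm_minus[of "\<lambda>i. f i - g i"] by simp

lemma bounded_op_in_l2: "bounded_op \<pi> S \<Longrightarrow> f \<in> l2 \<pi> \<Longrightarrow> S f \<in> l2 \<pi>"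
  by (simp add: bounded_op_def)

lemma bounded_op_add:
  "bounded_op \<pi> S \<Longrightarrow> f \<in> l2 \<pi> \<Longrightarrow> g \<in> l2 \<pi> \<Longrightarrow> S (\<lambda>i. f i + g i) = (\<lambda>i. S f i + S g i)"
  by (simp add: bounded_op_def)

lemma bounded_op_scale:
  "bounded_op \<pi> S \<Longrightarrow> f \<in> l2 \<pi> \<Longrightarrow> S (\<lambda>i. c * f i) = (\<lambda>i. c * S f i)"
  by (simp add: bounded_op_def)

lemma bounded_op_diff:
  "bounded_op \<pi> S \<Longrightarrow> f \<in> l2 \<pi> \<Longrightarrow> g \<in> l2 \<pi> \<Longrightarrow> S (\<lambda>i. f i - g i) = (\<lambda>i. S f i - S g i)"
  using bounded_op_add[of S f "\<lambda>i. - g i"] bounded_op_scale[of S g "-1"] l2_minus[of g] by simp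

lemma bounded_op_zero: "bounded_op \<pi> S \<Longrightarrow> S (\<lambda>i. 0) = (\<lambda>i. 0)"
  using bounded_op_scale[of S "\<lambda>i. 0" 0] by simp

lemma bounded_op_sum:
  assumes S: "bounded_op \<pi> S" and "finite X" "\<And>x. x \<in> X \<Longrightarrow> F x \<in> l2 \<pi>"
  shows "S (\<lambda>i. \<Sum>x\<in>X. F x i) = (\<lambda>i. \<Sum>x\<in>X. S (F x) i)"
  using assms(2,3)
proof (induction X)
  case empty
  then show ?case by (simp add: bounded_op_zero[OF S])
next
  case (insert x X)
  then show ?case
    using bounded_op_add[OF S, of "F x" "\<lambda>i. \<Sum>x\<in>X. F x i"] l2_sum[of X F] by simp
qed

lemma bounded_opE:
  assumes "bounded_op \<pi> S"
  obtains K where "0 < K" "\<And>f. f \<in> l2 \<pi> \<Longrightarrow> l2norm \<pi> (S f) \<le> K * l2norm \<pi> f"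
proof -
  obtain K where K: "\<And>f. f \<in> l2 \<pi> \<Longrightarrow> l2norm \<pi> (S f) \<le> K * l2norm \<pi> f"
    using assms unfolding bounded_op_def by blast
  show thesis
  proof (rule that[of "max 1 K"])
    show "l2norm \<pi> (S f) \<le> max 1 K * l2norm \<pi> f" if "f \<in> l2 \<pi>" for f
      using K[OF that] mult_right_mono[of K "max 1 K" "l2norm \<pi> f"] that by simp
  qed simp
qed

lemma bounded_op_funpow:
  assumes S: "bounded_op \<pi> S"
  shows "bounded_op \<pi> (S ^^ n)"
proof (induction n)
  case 0
  then show ?case by (auto simp: bounded_op_def intro!: exI[of _ 1])
next
  case (Suc n)
  obtain K where K: "0 < K" "\<And>f. f \<in> l2 \<pi> \<Longrightarrow> l2norm \<pi> (S f) \<le> K * l2norm \<pi> f"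
    by (rule bounded_opE[OF S]) auto
  obtain J where J: "0 < J" "\<And>f. f \<in> l2 \<pi> \<Longrightarrow> l2norm \<pi> ((S ^^ n) f) \<le> J * l2norm \<pi> f"
    by (rule bounded_opE[OF Suc.IH]) auto
  note [simp] = bounded_op_in_l2[OF S] bounded_op_in_l2[OF Suc.IH]
    bounded_op_add[OF S] bounded_op_scale[OF S] bounded_op_add[OF Suc.IH] bounded_op_scale[OF Suc.IH]
  have "l2norm \<pi> (S ((S ^^ n) f)) \<le> (K * J) * l2norm \<pi> f" if "f \<in> l2 \<pi>" for f
    using K(2)[of "(S ^^ n) f"] mult_left_mono[OF J(2)[OF that], of K] K(1) that
    by (auto simp: mult.assoc intro: order_trans)
  then show ?case
    unfolding bounded_op_def by auto
qed

definition unit_seq :: "nat \<Rightarrow> nat \<Rightarrow> complex" where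
  "unit_seq j = (\<lambda>i. if i = j then 1 else 0)"

lemma unit_seq_in_l2 [simp]: "unit_seq j \<in> l2 \<pi>"
  by (rule l2_eventually_zero[of "Suc j"]) (auto simp: unit_seq_def)

lemma sum_unit_seq: "(\<Sum>j<M. c j * unit_seq j i) = (if i < M then c i else 0)"
  by (simp add: unit_seq_def sum.delta' if_distrib[of "\<lambda>x. _ * x"] cong: if_cong)

lemma bounded_op_coordinate_bound:
  assumes "bounded_op \<pi> S"
  obtains C where "0 < C" "\<And>f. f \<in> l2 \<pi> \<Longrightarrow> cmod (S f i) \<le> C * l2norm \<pi> f"
proof -
  obtain K where K: "0 < K" "\<And>f. f \<in> l2 \<pi> \<Longrightarrow> l2norm \<pi> (S f) \<le> K * l2norm \<pi> f"
    by (rule bounded_opE[OF assms]) auto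
  have "cmod (S f i) \<le> K / sqrt (\<pi> i) * l2norm \<pi> f" if "f \<in> l2 \<pi>" for f
    using coordinate_le_l2norm[OF bounded_op_in_l2[OF assms that], of i]
      divide_right_mono[OF K(2)[OF that], of "sqrt (\<pi> i)"] by simp
  then show thesis using that[of "K / sqrt (\<pi> i)"] K(1) weight_pos[of i] by simp
qed

text \<open>A bounded operator commutes with absolutely convergent series. It is enough to have this in every
  coordinate, since coordinates are continuous on the weighted space.\<close>

lemma bounded_op_suminf:
  fixes F :: "nat \<Rightarrow> nat \<Rightarrow> complex"
  assumes S: "bounded_op \<pi> S"
    and F: "\<And>k. F k \<in> l2 \<pi>" and Fb: "\<And>k. l2norm \<pi> (F k) \<le> b k" and b: "summable b"
  shows "(\<lambda>k. S (F k) i) sums S (\<lambda>i. \<Sum>k. F k i) i"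
proof -
  let ?G = "\<lambda>i. \<Sum>k. F k i"
  have G: "?G \<in> l2 \<pi>" by (rule l2_suminf[OF F Fb b])
  obtain C where C: "0 < C" "\<And>f. f \<in> l2 \<pi> \<Longrightarrow> cmod (S f i) \<le> C * l2norm \<pi> f"
    by (rule bounded_op_coordinate_bound[OF S]) auto
  have "(\<lambda>n. suminf b - (\<Sum>k<n. b k)) \<longlonglongrightarrow> suminf b - suminf b"
    by (intro tendsto_diff tendsto_const summable_LIMSEQ b)
  then have "(\<lambda>n. C * (suminf b - (\<Sum>k<n. b k))) \<longlonglongrightarrow> 0"
    by (intro tendsto_mult_right_zero) simp
  then have "(\<lambda>n. (\<Sum>k<n. S (F k) i) - S ?G i) \<longlonglongrightarrow> 0"
  proof (rule Lim_null_comparison[rotated], intro always_eventually allI)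
    fix n
    let ?D = "\<lambda>i. ?G i - (\<Sum>k<n. F k i)"
    have D: "?D \<in> l2 \<pi>" by (intro l2_diff G l2_sum F) simp
    have "S ?D i = S ?G i - (\<Sum>k<n. S (F k) i)"
      by (subst bounded_op_diff[OF S G l2_sum]) (simp_all add: F bounded_op_sum[OF S])
    then have "norm ((\<Sum>k<n. S (F k) i) - S ?G i) = cmod (S ?D i)" by (simp add: norm_minus_commute)
    also have "\<dots> \<le> C * l2norm \<pi> ?D" by (rule C(2)[OF D])
    also have "\<dots> \<le> C * (\<Sum>k. b (k + n))"
      using l2norm_suminf_tail[OF F Fb b, of n] C(1) by (intro mult_left_mono) simp_all
    finally show "norm ((\<Sum>k<n. S (F k) i) - S ?G i) \<le> C * (suminf b - (\<Sum>k<n. b k))"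
      by (simp add: suminf_minus_initial_segment[OF b])
  qed
  then show ?thesis unfolding sums_def by (rule LIM_zero_cancel)
qed

end

section \<open>Stationary kernels as contractions\<close>

text \<open>The variance is the mean square minus the square of the mean. Nonnegativity of the variance is
  Jensen's inequality, and its vanishing describes the case of equality.\<close>

lemma variance_identity:
  fixes p :: "nat \<Rightarrow> real" and f :: "nat \<Rightarrow> complex"
  assumes p: "\<And>j. 0 \<le> p j" "p sums 1" and sq: "summable (\<lambda>j. p j * (cmod (f j))\<^sup>2)"
  defines "c \<equiv> \<Sum>j. complex_of_real (p j) * f j"
  shows summable_mean: "summable (\<lambda>j. norm (complex_of_real (p j) * f j))"
    and variance_sums: "(\<lambda>j. p j * (cmod (f j - c))\<^sup>2) sums ((\<Sum>j. p j * (cmod (f j))\<^sup>2) - (cmod c)\<^sup>2)"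
proof -
  have le: "x \<le> 1 + x\<^sup>2" for x :: real
    using zero_le_power2[of "x - 1/2"] by (simp add: power2_eq_square field_simps)
  show s: "summable (\<lambda>j. norm (complex_of_real (p j) * f j))"
  proof (rule summable_comparison_test')
    show "summable (\<lambda>j. p j + p j * (cmod (f j))\<^sup>2)"
      using p(2) sq by (intro summable_add) (auto simp: sums_iff)
    show "norm (norm (complex_of_real (p j) * f j)) \<le> p j + p j * (cmod (f j))\<^sup>2" if "j \<ge> 0" for j
      using mult_left_mono[OF le[of "cmod (f j)"] p(1)[of j]] p(1)[of j]
      by (simp add: norm_mult algebra_simps)
  qed
  have c: "(\<lambda>j. complex_of_real (p j) * f j) sums c"
    unfolding c_def using summable_norm_cancel[OF s] by (rule summable_sums)
  have "(\<lambda>j. cnj c * (complex_of_real (p j) * f j)) sums (cnj c * c)"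
    by (rule sums_mult[OF c])
  then have "(\<lambda>j. Re (cnj c * (complex_of_real (p j) * f j))) sums Re (cnj c * c)"
    by (rule sums_Re)
  moreover have "Re (cnj c * c) = (cmod c)\<^sup>2"
    unfolding cmod_power2 by (simp add: power2_eq_square)
  ultimately have re: "(\<lambda>j. Re (cnj c * (complex_of_real (p j) * f j))) sums (cmod c)\<^sup>2"
    by (simp only:)
  have "(\<lambda>j. p j * (cmod (f j))\<^sup>2 - 2 * Re (cnj c * (complex_of_real (p j) * f j)) + p j * (cmod c)\<^sup>2)
      sums ((\<Sum>j. p j * (cmod (f j))\<^sup>2) - 2 * (cmod c)\<^sup>2 + 1 * (cmod c)\<^sup>2)"
    by (intro sums_add sums_diff sums_mult sums_mult2 re p(2) summable_sums[OF sq])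
  moreover have "p j * (cmod (f j))\<^sup>2 - 2 * Re (cnj c * (complex_of_real (p j) * f j)) + p j * (cmod c)\<^sup>2
      = p j * (cmod (f j - c))\<^sup>2" for j
    unfolding cmod_power2 by (simp add: power2_eq_square algebra_simps)
  ultimately show "(\<lambda>j. p j * (cmod (f j - c))\<^sup>2) sums ((\<Sum>j. p j * (cmod (f j))\<^sup>2) - (cmod c)\<^sup>2)"
    by simp
qed

locale probability_weight = positive_weight +
  assumes weight_sums: "\<pi> sums 1"
begin

lemma
  assumes "\<And>i. cmod (f i) \<le> B"
  shows l2_if_bounded: "f \<in> l2 \<pi>"
    and l2norm_le_if_bounded: "l2norm \<pi> f \<le> B"
proof -
  have B: "0 \<le> B" using assms[of 0] norm_ge_zero[of "f 0"] by linarith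
  have *: "section_norm n f \<le> B" for n
  proof -
    have "(\<Sum>i<n. (cmod (f i))\<^sup>2 * \<pi> i) \<le> (\<Sum>i<n. B\<^sup>2 * \<pi> i)"
      by (intro sum_mono mult_right_mono power_mono assms) auto
    also have "\<dots> = B\<^sup>2 * (\<Sum>i<n. \<pi> i)" by (simp add: sum_distrib_left)
    also have "(\<Sum>i<n. \<pi> i) \<le> 1"
      using sum_le_suminf[of \<pi> "{..<n}"] weight_sums by (auto simp: sums_iff)
    finally have "(section_norm n f)\<^sup>2 \<le> B\<^sup>2"
      unfolding section_norm_sq by (simp add: mult_left_mono)
    then show ?thesis using B power2_le_imp_le by blast
  qed
  show "f \<in> l2 \<pi>" by (rule l2_if_sections_bounded[OF *])
  show "l2norm \<pi> f \<le> B" by (rule l2norm_le_if_sections_bounded[OF *])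
qed

lemma l2norm_const: "l2norm \<pi> (\<lambda>_. c) = cmod c"
proof -
  have "(\<lambda>i. (cmod c)\<^sup>2 * \<pi> i) sums ((cmod c)\<^sup>2 * 1)" by (intro sums_mult weight_sums)
  then show ?thesis by (simp add: l2norm_def sums_iff)
qed

text \<open>Bounded sequences of functions on a discrete space with a finite measure: by dominated convergence,
  convergence at every state suffices for convergence in norm.\<close>

lemma l2_bounded_convergence:
  assumes b: "\<And>k i. cmod (F k i) \<le> B" and lim: "\<And>i. (\<lambda>k. F k i) \<longlonglongrightarrow> f i"
  shows "(\<lambda>k. l2norm \<pi> (\<lambda>i. F k i - f i)) \<longlonglongrightarrow> 0"
proof -
  have fb: "cmod (f i) \<le> B" for i
    by (rule LIMSEQ_le_const2[OF tendsto_norm[OF lim]]) (use b in auto)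
  have sm: "summable (\<lambda>i. (2 * B)\<^sup>2 * \<pi> i)"
    using weight_sums by (intro summable_mult) (auto simp: sums_iff)
  have bd: "norm ((cmod (F k i - f i))\<^sup>2 * \<pi> i) \<le> (2 * B)\<^sup>2 * \<pi> i" for k i
  proof -
    have "cmod (F k i - f i) \<le> 2 * B"
      using norm_triangle_ineq4[of "F k i" "f i"] b[of k i] fb[of i] by linarith
    then have "(cmod (F k i - f i))\<^sup>2 \<le> (2 * B)\<^sup>2" by (rule power_mono) simp
    then show ?thesis by (auto intro: mult_right_mono simp del: power_mult_distrib)
  qed
  have "((\<lambda>k. \<Sum>i. (cmod (F k i - f i))\<^sup>2 * \<pi> i) \<longlongrightarrow> (\<Sum>i. 0)) sequentially"
  proof (rule tannerys_theorem[THEN conjunct2, THEN conjunct2])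
    show "((\<lambda>k. (cmod (F k i - f i))\<^sup>2 * \<pi> i) \<longlongrightarrow> 0) sequentially" for i
      by (auto intro!: tendsto_eq_intros lim)
    show "eventually (\<lambda>(i,k). norm ((cmod (F k i - f i))\<^sup>2 * \<pi> i) \<le> (2 * B)\<^sup>2 * \<pi> i) (at_top \<times>\<^sub>F sequentially)"
      using bd by (intro always_eventually) auto
  qed (use sm in auto)
  then have "(\<lambda>k. sqrt (\<Sum>i. (cmod (F k i - f i))\<^sup>2 * \<pi> i)) \<longlonglongrightarrow> sqrt 0"
    by (intro tendsto_real_sqrt) simp
  then show ?thesis by (simp add: l2norm_def)
qed

lemma l2_mean:
  assumes "f \<in> l2 \<pi>"
  shows summable_weighted: "summable (\<lambda>i. norm (f i * complex_of_real (\<pi> i)))"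
    and l2norm_mean_op: "l2norm \<pi> (mean_op \<pi> f) \<le> l2norm \<pi> f"
proof -
  have sq: "summable (\<lambda>j. \<pi> j * (cmod (f j))\<^sup>2)"
    using assms by (simp add: l2_def mult.commute)
  note v = summable_mean[of \<pi> f, OF _ weight_sums sq] variance_sums[of \<pi> f, OF _ weight_sums sq]
  show "summable (\<lambda>i. norm (f i * complex_of_real (\<pi> i)))"
    using v(1) by (simp add: mult.commute)
  let ?c = "\<Sum>j. complex_of_real (\<pi> j) * f j"
  have "0 \<le> (\<Sum>j. \<pi> j * (cmod (f j))\<^sup>2) - (cmod ?c)\<^sup>2"
    by (rule sums_le[OF _ sums_zero v(2)]) auto
  then have "(cmod ?c) \<le> l2norm \<pi> f"
    unfolding l2norm_def by (intro real_le_rsqrt) (simp add: mult.commute)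
  then show "l2norm \<pi> (mean_op \<pi> f) \<le> l2norm \<pi> f"
    unfolding mean_op_def l2norm_const by (simp add: mult.commute)
qed

lemma mean_op_in_l2 [simp]: "mean_op \<pi> f \<in> l2 \<pi>"
  unfolding mean_op_def by (rule l2_if_bounded) (rule order_refl)

lemma mean_op_const: "mean_op \<pi> (\<lambda>_. c) = (\<lambda>_. c)"
proof -
  have "(\<lambda>i. c * complex_of_real (\<pi> i)) sums (c * complex_of_real 1)"
    by (intro sums_mult sums_of_real weight_sums)
  then show ?thesis by (simp add: mean_op_def sums_iff)
qed

lemma mean_op_diff:
  assumes "f \<in> l2 \<pi>" "g \<in> l2 \<pi>"
  shows "mean_op \<pi> (\<lambda>i. f i - g i) = (\<lambda>i. mean_op \<pi> f i - mean_op \<pi> g i)"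
  unfolding mean_op_def left_diff_distrib
  using summable_norm_cancel[OF summable_weighted[OF assms(1)]]
    summable_norm_cancel[OF summable_weighted[OF assms(2)]]
  by (simp add: suminf_diff)

end

locale stationary_markov = probability_weight +
  fixes P :: "nat \<Rightarrow> nat \<Rightarrow> real"
  assumes P_nonneg [simp]: "0 \<le> P i j"
    and P_sums: "P i sums 1"
    and stationary: "(\<lambda>i. \<pi> i * P i j) sums \<pi> j"
begin

lemma weighted_entry_le: "\<pi> i * P i j \<le> \<pi> j"
  using sum_le_suminf[of "\<lambda>i. \<pi> i * P i j" "{i}"] stationary[of j] by (simp add: sums_iff)

lemma weighted_column_le: "(\<Sum>i<n. \<pi> i * P i j) \<le> \<pi> j"
  using sum_le_suminf[of "\<lambda>i. \<pi> i * P i j" "{..<n}"] stationary[of j] by (simp add: sums_iff)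

lemma summable_row_sq:
  assumes "f \<in> l2 \<pi>"
  shows "summable (\<lambda>j. P i j * (cmod (f j))\<^sup>2)"
proof (rule summable_comparison_test')
  show "summable (\<lambda>j. (cmod (f j))\<^sup>2 * \<pi> j / \<pi> i)"
    using assms by (intro summable_divide) (simp add: l2_def)
  show "norm (P i j * (cmod (f j))\<^sup>2) \<le> (cmod (f j))\<^sup>2 * \<pi> j / \<pi> i" if "j \<ge> 0" for j
    using mult_right_mono[OF weighted_entry_le[of i j], of "(cmod (f j))\<^sup>2"] weight_pos[of i]
    by (simp add: field_simps)
qed

lemma summable_row: "f \<in> l2 \<pi> \<Longrightarrow> summable (\<lambda>j. norm (complex_of_real (P i j) * f j))"
  by (rule summable_mean[OF P_nonneg P_sums summable_row_sq])

text \<open>The variance of \<open>f\<close> under the probability measure \<open>P i\<close>, that is, of \<open>f\<close> after one step from \<open>i\<close>.\<close>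

definition row_variance :: "(nat \<Rightarrow> complex) \<Rightarrow> nat \<Rightarrow> real" where
  "row_variance f i = (\<Sum>j. P i j * (cmod (f j - kernel_op P f i))\<^sup>2)"

lemma row_variance_sums:
  "f \<in> l2 \<pi> \<Longrightarrow> (\<lambda>j. P i j * (cmod (f j - kernel_op P f i))\<^sup>2) sums row_variance f i"
  using variance_sums[OF P_nonneg P_sums summable_row_sq[of f i]]
  unfolding row_variance_def kernel_op_def by (simp add: sums_iff)

lemma row_variance_eq:
  "f \<in> l2 \<pi> \<Longrightarrow> (cmod (kernel_op P f i))\<^sup>2 + row_variance f i = (\<Sum>j. P i j * (cmod (f j))\<^sup>2)"
  using variance_sums[OF P_nonneg P_sums summable_row_sq[of f i]]
  unfolding row_variance_def kernel_op_def by (simp add: sums_iff)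

lemma row_variance_nonneg: "f \<in> l2 \<pi> \<Longrightarrow> 0 \<le> row_variance f i"
  by (rule sums_le[OF _ sums_zero row_variance_sums]) auto

text \<open>By stationarity \<open>\<pi> (P |f|\<^sup>2) = \<pi> |f|\<^sup>2\<close>, and \<open>P |f|\<^sup>2 = |P f|\<^sup>2 +\<close> variance. Keeping the variance makes
  the contraction property quantitative. For finitely many rows, stationarity turns into
  the inequality \<open>\<Sum>i<n. \<pi> i P i j \<le> \<pi> j\<close> for the columns.\<close>

lemma contraction_with_variance:
  assumes f: "f \<in> l2 \<pi>"
  shows "(\<Sum>i<n. \<pi> i * ((cmod (kernel_op P f i))\<^sup>2 + row_variance f i)) \<le> (l2norm \<pi> f)\<^sup>2"
proof -
  have s: "summable (\<lambda>j. (cmod (f j))\<^sup>2 * \<pi> j)" using f by (simp add: l2_def)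
  have sm: "summable (\<lambda>j. \<pi> i * (P i j * (cmod (f j))\<^sup>2))" for i
    by (intro summable_mult summable_row_sq f)
  have "(\<Sum>i<n. \<pi> i * ((cmod (kernel_op P f i))\<^sup>2 + row_variance f i))
      = (\<Sum>i<n. \<Sum>j. \<pi> i * (P i j * (cmod (f j))\<^sup>2))"
    by (simp add: row_variance_eq[OF f] suminf_mult summable_row_sq[OF f])
  also have "\<dots> = (\<Sum>j. \<Sum>i<n. \<pi> i * (P i j * (cmod (f j))\<^sup>2))"
    by (rule suminf_sum[symmetric]) (rule sm)
  also have "\<dots> \<le> (\<Sum>j. (cmod (f j))\<^sup>2 * \<pi> j)"
  proof (rule suminf_le)
    show "(\<Sum>i<n. \<pi> i * (P i j * (cmod (f j))\<^sup>2)) \<le> (cmod (f j))\<^sup>2 * \<pi> j" for j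
    proof -
      have "(\<Sum>i<n. \<pi> i * (P i j * (cmod (f j))\<^sup>2)) = (\<Sum>i<n. \<pi> i * P i j) * (cmod (f j))\<^sup>2"
        by (simp add: sum_distrib_right mult.assoc)
      also have "\<dots> \<le> \<pi> j * (cmod (f j))\<^sup>2"
        by (intro mult_right_mono weighted_column_le) simp
      finally show ?thesis by (simp add: mult.commute)
    qed
  qed (use sm s in \<open>auto intro: summable_sum\<close>)
  also have "\<dots> = (l2norm \<pi> f)\<^sup>2"
    unfolding l2norm_def by (simp add: suminf_nonneg[OF s])
  finally show ?thesis .
qed

lemma
  assumes f: "f \<in> l2 \<pi>"
  shows kernel_op_in_l2: "kernel_op P f \<in> l2 \<pi>"
    and kernel_op_contraction: "l2norm \<pi> (kernel_op P f) \<le> l2norm \<pi> f"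
proof -
  have *: "section_norm n (kernel_op P f) \<le> l2norm \<pi> f" for n
  proof -
    have "(section_norm n (kernel_op P f))\<^sup>2
        \<le> (\<Sum>i<n. \<pi> i * ((cmod (kernel_op P f i))\<^sup>2 + row_variance f i))"
      unfolding section_norm_sq
    proof (rule sum_mono)
      fix i
      have "\<pi> i * (cmod (kernel_op P f i))\<^sup>2
          \<le> \<pi> i * ((cmod (kernel_op P f i))\<^sup>2 + row_variance f i)"
        by (intro mult_left_mono) (simp_all add: row_variance_nonneg[OF f])
      then show "(cmod (kernel_op P f i))\<^sup>2 * \<pi> i
          \<le> \<pi> i * ((cmod (kernel_op P f i))\<^sup>2 + row_variance f i)"
        by (simp only: mult.commute)
    qed
    also note contraction_with_variance[OF f]
    finally show ?thesis by (rule power2_le_imp_le) (simp add: f)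
  qed
  show "kernel_op P f \<in> l2 \<pi>" by (rule l2_if_sections_bounded[OF *])
  show "l2norm \<pi> (kernel_op P f) \<le> l2norm \<pi> f" by (rule l2norm_le_if_sections_bounded[OF *])
qed

text \<open>If no norm is lost, then every row variance vanishes.\<close>

lemma isometry_imp_constant_on_row:
  assumes f: "f \<in> l2 \<pi>" and iso: "l2norm \<pi> (kernel_op P f) = l2norm \<pi> f" and pos: "0 < P i j"
  shows "f j = kernel_op P f i"
proof -
  have s: "summable (\<lambda>i. (cmod (kernel_op P f i))\<^sup>2 * \<pi> i)"
    using kernel_op_in_l2[OF f] by (simp add: l2_def)
  have part: "(\<Sum>k<n. (cmod (kernel_op P f k))\<^sup>2 * \<pi> k) \<le> (l2norm \<pi> f)\<^sup>2 - \<pi> i * row_variance f i" for n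
  proof -
    let ?m = "max n (Suc i)"
    have "(\<Sum>k<n. (cmod (kernel_op P f k))\<^sup>2 * \<pi> k) \<le> (\<Sum>k<?m. (cmod (kernel_op P f k))\<^sup>2 * \<pi> k)"
      by (intro sum_mono2) auto
    moreover have "\<pi> i * row_variance f i \<le> (\<Sum>k<?m. \<pi> k * row_variance f k)"
      by (rule member_le_sum) (auto simp: row_variance_nonneg[OF f])
    moreover have "(\<Sum>k<?m. (cmod (kernel_op P f k))\<^sup>2 * \<pi> k) + (\<Sum>k<?m. \<pi> k * row_variance f k)
        \<le> (l2norm \<pi> f)\<^sup>2"
      using contraction_with_variance[OF f, of ?m] by (simp add: sum.distrib algebra_simps)
    ultimately show ?thesis by linarith
  qed
  have "(l2norm \<pi> (kernel_op P f))\<^sup>2 = (\<Sum>k. (cmod (kernel_op P f k))\<^sup>2 * \<pi> k)"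
    unfolding l2norm_def by (simp add: suminf_nonneg[OF s])
  also have "\<dots> \<le> (l2norm \<pi> f)\<^sup>2 - \<pi> i * row_variance f i"
    by (rule suminf_le_const[OF s part])
  finally have "\<pi> i * row_variance f i \<le> 0" using iso by simp
  then have "row_variance f i \<le> 0"
    using weight_pos[of i] by (simp add: mult_le_0_iff)
  moreover have "P i j * (cmod (f j - kernel_op P f i))\<^sup>2 \<le> row_variance f i"
    using sum_le_suminf[of "\<lambda>j. P i j * (cmod (f j - kernel_op P f i))\<^sup>2" "{j}"]
      row_variance_sums[OF f, of i] by (simp add: sums_iff)
  ultimately have "P i j * (cmod (f j - kernel_op P f i))\<^sup>2 \<le> 0" by linarith
  then show ?thesis using pos by (simp add: mult_le_0_iff)
qed

lemma kernel_op_add: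
  "f \<in> l2 \<pi> \<Longrightarrow> g \<in> l2 \<pi> \<Longrightarrow>
    kernel_op P (\<lambda>i. f i + g i) = (\<lambda>i. kernel_op P f i + kernel_op P g i)"
  unfolding kernel_op_def distrib_left
  by (rule ext, rule suminf_add[symmetric]) (auto intro: summable_norm_cancel summable_row)

lemma kernel_op_scale:
  "f \<in> l2 \<pi> \<Longrightarrow> kernel_op P (\<lambda>i. c * f i) = (\<lambda>i. c * kernel_op P f i)"
  unfolding kernel_op_def
  using suminf_mult[OF summable_norm_cancel[OF summable_row[of f]]]
  by (simp add: mult.left_commute[of _ c])

lemma bounded_op_kernel_op: "bounded_op \<pi> (kernel_op P)"
  unfolding bounded_op_def
  using kernel_op_in_l2 kernel_op_contraction kernel_op_add kernel_op_scale
  by (auto intro!: exI[of _ 1])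

lemma kernel_op_const: "kernel_op P (\<lambda>_. c) = (\<lambda>_. c)"
proof
  fix i
  have "(\<lambda>j. complex_of_real (P i j) * c) sums (complex_of_real 1 * c)"
    by (intro sums_mult2 sums_of_real P_sums)
  then show "kernel_op P (\<lambda>_. c) i = c" by (simp add: kernel_op_def sums_iff)
qed

text \<open>The array \<open>\<pi> i P i j f j\<close> is absolutely summable and is summed in both orders.\<close>

lemma mean_op_kernel_op:
  assumes f: "f \<in> l2 \<pi>"
  shows "mean_op \<pi> (kernel_op P f) = mean_op \<pi> f"
proof -
  define a where "a = (\<lambda>(j, i). complex_of_real (\<pi> i * P i j) * f j)"
  have col: "((\<lambda>i. complex_of_real (\<pi> i * P i j) * f j) has_sum (complex_of_real (\<pi> j) * f j)) UNIV" for j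
  proof (rule norm_summable_imp_has_sum)
    show "summable (\<lambda>i. norm (complex_of_real (\<pi> i * P i j) * f j))"
      using summable_mult2[of "\<lambda>i. \<pi> i * P i j" "norm (f j)"] stationary[of j]
      by (simp add: sums_iff norm_mult abs_mult)
    show "(\<lambda>i. complex_of_real (\<pi> i * P i j) * f j) sums (complex_of_real (\<pi> j) * f j)"
      by (intro sums_mult2 sums_of_real stationary)
  qed
  have ncol: "((\<lambda>i. norm (complex_of_real (\<pi> i * P i j) * f j)) has_sum (\<pi> j * norm (f j))) UNIV" for j
    using sums_mult2[OF stationary[of j], of "norm (f j)"]
    by (intro sums_nonneg_imp_has_sum) (auto simp: norm_mult abs_mult)
  have abs: "(\<lambda>x. norm (a x)) summable_on (UNIV \<times> UNIV)"
    unfolding Infinite_Sum.abs_summable_on_Sigma_iff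
  proof (intro conjI ballI)
    show "(\<lambda>i. norm (a (j, i))) summable_on UNIV" for j
      using ncol[of j] by (auto simp: a_def has_sum_imp_summable)
    have "(\<lambda>j. norm (infsum (\<lambda>i. norm (a (j, i))) UNIV)) = (\<lambda>j. norm (f j * complex_of_real (\<pi> j)))"
      using infsumI[OF ncol] by (auto simp: a_def norm_mult mult.commute fun_eq_iff)
    then show "(\<lambda>j. norm (infsum (\<lambda>i. norm (a (j, i))) UNIV)) summable_on UNIV"
      using norm_summable_imp_summable_on[of "\<lambda>j. norm (f j * complex_of_real (\<pi> j))"]
        summable_weighted[OF f] by simp
  qed
  have "infsum (\<lambda>j. infsum (\<lambda>i. a (j, i)) UNIV) UNIV = infsum (\<lambda>i. infsum (\<lambda>j. a (j, i)) UNIV) UNIV"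
    using abs_summable_summable[OF abs] infsum_swap_banach[of "\<lambda>j i. a (j, i)" UNIV UNIV] by simp
  moreover have "infsum (\<lambda>i. a (j, i)) UNIV = f j * complex_of_real (\<pi> j)" for j
    using infsumI[OF col[of j]] by (simp add: a_def mult.commute)
  moreover have "infsum (\<lambda>j. a (j, i)) UNIV = kernel_op P f i * complex_of_real (\<pi> i)" for i
  proof (rule infsumI, rule norm_summable_imp_has_sum)
    show "summable (\<lambda>j. norm (a (j, i)))"
      using summable_mult[OF summable_row[OF f, of i], of "\<pi> i"]
      by (simp add: a_def norm_mult abs_mult mult.assoc)
    have "(\<lambda>j. (complex_of_real (P i j) * f j) * complex_of_real (\<pi> i))
        sums (kernel_op P f i * complex_of_real (\<pi> i))"
      unfolding kernel_op_def
      by (intro sums_mult2 summable_sums summable_norm_cancel[OF summable_row[OF f]])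
    then show "(\<lambda>j. a (j, i)) sums (kernel_op P f i * complex_of_real (\<pi> i))"
      by (simp add: a_def mult_ac)
  qed
  moreover have "infsum (\<lambda>i. g i * complex_of_real (\<pi> i)) UNIV = (\<Sum>i. g i * complex_of_real (\<pi> i))"
    if "g \<in> l2 \<pi>" for g
    using summable_weighted[OF that]
    by (intro infsumI norm_summable_imp_has_sum summable_sums) (auto intro: summable_norm_cancel)
  ultimately show ?thesis
    using f kernel_op_in_l2[OF f] by (simp add: mean_op_def)
qed

end

section \<open>Paths of equal length\<close>

lemma kernel_power_bounds:
  assumes "markov_kernel P"
  shows "0 \<le> kernel_power P n i j \<and> kernel_power P n i j \<le> 1"
proof (induction n arbitrary: i)
  case (Suc n)
  have P: "0 \<le> P i k" "summable (P i)" "suminf (P i) = 1" for i k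
    using assms by (auto simp: markov_kernel_def sums_iff)
  have le: "P i k * kernel_power P n k j \<le> P i k" for k
    using mult_left_mono[of _ 1 "P i k"] Suc[of k] P(1) by simp
  have s: "summable (\<lambda>k. P i k * kernel_power P n k j)"
    by (rule summable_comparison_test'[OF P(2)[of i]]) (use le Suc P(1) in auto)
  show ?case
    using suminf_nonneg[OF s] suminf_le[OF le s P(2)] P(1,3) Suc by simp
qed auto

lemma kernel_power_pos_imp_path:
  assumes "markov_kernel P" and "0 < kernel_power P n i j"
  shows "(i, j) \<in> {(i, j). 0 < P i j} ^^ n"
  using assms(2)
proof (induction n arbitrary: i)
  case 0
  then show ?case by (auto split: if_splits)
next
  case (Suc n)
  have "\<exists>k. P i k * kernel_power P n k j \<noteq> 0"
  proof (rule ccontr)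
    assume "\<not> ?thesis"
    then have "(\<lambda>k. P i k * kernel_power P n k j) = (\<lambda>_. 0)" by auto
    then have "kernel_power P (Suc n) i j = 0" by (simp only: kernel_power.simps suminf_zero)
    then show False using Suc.prems by simp
  qed
  then obtain k where k: "P i k \<noteq> 0" "kernel_power P n k j \<noteq> 0" by auto
  have "0 < P i k" using k(1) assms(1) by (auto simp: markov_kernel_def less_le)
  moreover have "0 < kernel_power P n k j" using k(2) kernel_power_bounds[OF assms(1), of n k j] by simp
  ultimately show ?case using Suc.IH by (blast intro: relpow_Suc_I2)
qed

text \<open>The lengths of loops at \<open>j\<close> form an additive monoid whose differences form a group of integers. By
  aperiodicity this group is everything, so it contains the length \<open>t\<close> of a path from \<open>j\<close> to \<open>j'\<close>, say
  \<open>t = a - b\<close> for two loop lengths. A loop of length \<open>b\<close> followed by that path and a loop of length \<open>a\<close>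
  have the same length and start at \<open>j\<close>.\<close>

lemma equal_length_paths:
  assumes "markov_kernel P" "irreducible_kernel P" "aperiodic_kernel P"
  shows "\<exists>i n. (i, j) \<in> {(i, j). 0 < P i j} ^^ n \<and> (i, j') \<in> {(i, j). 0 < P i j} ^^ n"
proof -
  let ?R = "{(i, j). 0 < P i j}"
  obtain t where t: "(j, j') \<in> ?R ^^ t"
    using assms(2) kernel_power_pos_imp_path[OF assms(1)] unfolding irreducible_kernel_def by blast
  let ?A = "{n. 1 \<le> n \<and> kernel_power P n j j > 0}"
  define S where "S = {n. (j, j) \<in> ?R ^^ n}"
  have S0: "0 \<in> S" by (simp add: S_def)
  have Sadd: "a + b \<in> S" if "a \<in> S" "b \<in> S" for a b
    using that relpow_trans[of j j a ?R j b] by (auto simp: S_def)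
  have AS: "?A \<subseteq> S" using kernel_power_pos_imp_path[OF assms(1)] by (auto simp: S_def)
  have "x \<in> group_closure (int ` ?A) \<Longrightarrow> \<exists>a\<in>S. \<exists>b\<in>S. x = int a - int b" for x
  proof (induction rule: group_closure.induct)
    case (base s)
    then show ?case using AS S0 by (fastforce intro: bexI[of _ 0])
  next
    case (diff s t)
    then obtain a b c d where "a \<in> S" "b \<in> S" "c \<in> S" "d \<in> S" "s = int a - int b" "t = int c - int d"
      by blast
    then show ?case using Sadd[of a d] Sadd[of b c] by (intro bexI[of _ "a + d"] bexI[of _ "b + c"]) auto
  qed
  moreover have "int t \<in> group_closure (int ` ?A)"
    using assms(3) unfolding aperiodic_kernel_def group_closure_eq by (simp add: Gcd_int_eq)
  ultimately obtain a b where ab: "a \<in> S" "b \<in> S" "int t = int a - int b" by blast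
  then have "a = b + t" by linarith
  moreover have "(j, j') \<in> ?R ^^ (b + t)"
    using ab(2) t relpow_trans[of j j b ?R j' t] by (auto simp: S_def)
  ultimately show ?thesis using ab(1) by (auto simp: S_def)
qed

section \<open>Convergence of the iterates on bounded functions\<close>

context stationary_markov
begin

lemma bounded_op_iterate: "bounded_op \<pi> (kernel_op P ^^ n)"
  by (rule bounded_op_funpow[OF bounded_op_kernel_op])

lemmas iterate_in_l2 [simp] = bounded_op_in_l2[OF bounded_op_iterate]

lemma iterate_contraction:
  assumes "f \<in> l2 \<pi>"
  shows "l2norm \<pi> ((kernel_op P ^^ n) f) \<le> l2norm \<pi> f"
proof (induction n)
  case (Suc n)
  have "l2norm \<pi> ((kernel_op P ^^ Suc n) f) \<le> l2norm \<pi> ((kernel_op P ^^ n) f)"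
    using kernel_op_contraction[OF iterate_in_l2[OF assms]] by simp
  with Suc show ?case by linarith
qed simp

lemma iterate_const: "(kernel_op P ^^ n) (\<lambda>_. c) = (\<lambda>_. c)"
  by (induction n) (simp_all add: kernel_op_const)

lemma mean_op_iterate: "f \<in> l2 \<pi> \<Longrightarrow> mean_op \<pi> ((kernel_op P ^^ n) f) = mean_op \<pi> f"
  by (induction n) (simp_all add: mean_op_kernel_op)

lemma kernel_op_sup_bound:
  assumes "\<And>i. cmod (f i) \<le> B"
  shows "cmod (kernel_op P f i) \<le> B"
proof -
  have f: "f \<in> l2 \<pi>" by (rule l2_if_bounded[OF assms])
  have "cmod (kernel_op P f i) \<le> (\<Sum>j. norm (complex_of_real (P i j) * f j))"
    unfolding kernel_op_def by (rule summable_norm[OF summable_row[OF f]])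
  also have "\<dots> \<le> (\<Sum>j. P i j * B)"
    using P_sums[of i] assms
    by (intro suminf_le summable_row[OF f] summable_mult2)
      (auto simp: norm_mult sums_iff intro: mult_left_mono)
  also have "\<dots> = B" using sums_mult2[OF P_sums[of i], of B] by (simp add: sums_iff)
  finally show ?thesis .
qed

lemma iterate_sup_bound: "(\<And>i. cmod (f i) \<le> B) \<Longrightarrow> cmod ((kernel_op P ^^ n) f i) \<le> B"
  by (induction n arbitrary: i) (simp_all add: kernel_op_sup_bound)

text \<open>After \<open>n\<close> steps from \<open>i\<close> only one value of \<open>g\<close> can be seen, namely \<open>(P\<^sup>n g)(i)\<close>.\<close>

lemma isometric_orbit_along_path:
  assumes g: "g \<in> l2 \<pi>" and iso: "\<And>r. l2norm \<pi> ((kernel_op P ^^ r) g) = l2norm \<pi> g"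
    and path: "(i, j) \<in> {(i, j). 0 < P i j} ^^ n"
  shows "(kernel_op P ^^ s) g j = (kernel_op P ^^ (s + n)) g i"
  using path
proof (induction n arbitrary: j s)
  case (Suc n)
  then obtain k where k: "(i, k) \<in> {(i, j). 0 < P i j} ^^ n" "0 < P k j" by auto
  have "(kernel_op P ^^ s) g j = kernel_op P ((kernel_op P ^^ s) g) k"
    using isometry_imp_constant_on_row[OF iterate_in_l2[OF g], of s k j] k(2) iso[of "Suc s"] iso[of s]
    by simp
  also have "\<dots> = (kernel_op P ^^ (Suc s + n)) g i" using Suc.IH[OF k(1), of "Suc s"] by simp
  finally show ?case by simp
qed simp

text \<open>The convergence theorem for aperiodic irreducible stationary chains, in the form of convergence in
  norm. The norms of the centred iterates decrease to a limit, and this limit is the norm of every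
  iterate of a subsequential limit \<open>g\<close>, so that no norm is lost along the orbit of \<open>g\<close>.\<close>

theorem iterates_converge_to_mean:
  assumes paths: "\<And>j j'. \<exists>i n. (i, j) \<in> {(i, j). 0 < P i j} ^^ n \<and> (i, j') \<in> {(i, j). 0 < P i j} ^^ n"
    and bounded: "\<And>i. cmod (f i) \<le> B"
  shows "(\<lambda>n. l2norm \<pi> (\<lambda>i. (kernel_op P ^^ n) f i - mean_op \<pi> f i)) \<longlonglongrightarrow> 0"
proof -
  let ?K = "\<lambda>n. kernel_op P ^^ n"
  \<comment> \<open>It is enough to treat the centred function \<open>h\<close>, whose iterates are the deviations of those of \<open>f\<close>.\<close>
  define h where "h = (\<lambda>i. f i - mean_op \<pi> f i)"
  have f: "f \<in> l2 \<pi>" by (rule l2_if_bounded[OF bounded])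
  have h: "h \<in> l2 \<pi>" unfolding h_def by (intro l2_diff f mean_op_in_l2)
  have mean_const: "mean_op \<pi> (mean_op \<pi> u) = mean_op \<pi> u" and
    K_mean: "?K n (mean_op \<pi> u) = mean_op \<pi> u" for n u
    by (simp_all add: mean_op_def[of \<pi> u] mean_op_const iterate_const)
  have Kh: "?K n h = (\<lambda>i. ?K n f i - mean_op \<pi> f i)" for n
    unfolding h_def by (simp add: bounded_op_diff[OF bounded_op_iterate f mean_op_in_l2] K_mean)
  have mean_h: "mean_op \<pi> h = (\<lambda>i. 0)"
    unfolding h_def by (simp add: mean_op_diff[OF f mean_op_in_l2] mean_const)
  have hb: "cmod (h i) \<le> B + cmod (mean_op \<pi> f 0)" for i
    using norm_triangle_ineq4[of "f i" "mean_op \<pi> f i"] bounded[of i]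
    by (simp add: h_def mean_op_def)
  note Khb = iterate_sup_bound[where f = h, OF hb]
  obtain k where k: "strict_mono (k :: nat \<Rightarrow> nat)" and "\<And>i. \<exists>l. (\<lambda>m. ?K (k m) h i) \<longlonglongrightarrow> l"
    using function_convergent_subsequence[of UNIV "\<lambda>n. ?K n h"] Khb by auto
  then obtain g where g: "\<And>i. (\<lambda>m. ?K (k m) h i) \<longlonglongrightarrow> g i" by metis
  have gl2: "g \<in> l2 \<pi>"
    by (rule l2_pointwise_limit[where F = "\<lambda>m. ?K (k m) h" and B = "l2norm \<pi> h"])
      (simp_all add: h iterate_contraction g)
  have conv: "(\<lambda>m. l2norm \<pi> (\<lambda>i. ?K (k m) h i - g i)) \<longlonglongrightarrow> 0"
    by (rule l2_bounded_convergence[OF Khb g])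
  have dec: "decseq (\<lambda>n. l2norm \<pi> (?K n h))"
    unfolding decseq_Suc_iff using kernel_op_contraction[OF iterate_in_l2[OF h]] by simp
  then obtain L where L: "(\<lambda>n. l2norm \<pi> (?K n h)) \<longlonglongrightarrow> L"
    using decseq_convergent[of "\<lambda>n. l2norm \<pi> (?K n h)" 0] h by (metis iterate_in_l2 l2norm_nonneg)
  \<comment> \<open>\<open>P\<^sup>r g\<close> is the limit of the iterates of \<open>h\<close> along the subsequence shifted by \<open>r\<close>, and all
    subsequences of their norms have the limit \<open>L\<close>.\<close>
  have norm_g: "l2norm \<pi> (?K r g) = L" for r
  proof (rule LIMSEQ_unique)
    have "(\<lambda>m. l2norm \<pi> (?K r (?K (k m) h)) - l2norm \<pi> (?K r g)) \<longlonglongrightarrow> 0"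
    proof (rule Lim_null_comparison[OF always_eventually conv], rule allI)
      fix m
      have "\<bar>l2norm \<pi> (?K r (?K (k m) h)) - l2norm \<pi> (?K r g)\<bar>
          \<le> l2norm \<pi> (\<lambda>i. ?K r (?K (k m) h) i - ?K r g i)"
        by (rule l2norm_reverse_triangle) (simp_all add: h gl2)
      also have "\<dots> = l2norm \<pi> (?K r (\<lambda>i. ?K (k m) h i - g i))"
        by (simp add: bounded_op_diff[OF bounded_op_iterate] h gl2)
      also have "\<dots> \<le> l2norm \<pi> (\<lambda>i. ?K (k m) h i - g i)"
        by (rule iterate_contraction) (simp add: l2_diff h gl2)
      finally show "norm (l2norm \<pi> (?K r (?K (k m) h)) - l2norm \<pi> (?K r g))
          \<le> l2norm \<pi> (\<lambda>i. ?K (k m) h i - g i)" by simp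
    qed
    then show "(\<lambda>m. l2norm \<pi> (?K r (?K (k m) h))) \<longlonglongrightarrow> l2norm \<pi> (?K r g)"
      by (rule LIM_zero_cancel)
    have "(\<lambda>m. l2norm \<pi> (?K (k m + r) h)) \<longlonglongrightarrow> L"
      using LIMSEQ_subseq_LIMSEQ[OF LIMSEQ_ignore_initial_segment[OF L, of r] k] by (simp add: o_def)
    then show "(\<lambda>m. l2norm \<pi> (?K r (?K (k m) h))) \<longlonglongrightarrow> L"
      by (simp add: funpow_add add.commute)
  qed
  have iso: "l2norm \<pi> (?K r g) = l2norm \<pi> g" for r
    using norm_g[of r] norm_g[of 0] by simp
  have "g j = g j'" for j j'
  proof -
    obtain i n where "(i, j) \<in> {(i, j). 0 < P i j} ^^ n" "(i, j') \<in> {(i, j). 0 < P i j} ^^ n"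
      using paths by blast
    then show ?thesis
      using isometric_orbit_along_path[OF gl2 iso, of i _ n 0] by simp
  qed
  then have g_const: "g = (\<lambda>_. g 0)" by auto
  have "l2norm \<pi> g \<le> l2norm \<pi> (\<lambda>i. ?K (k m) h i - g i)" for m
  proof -
    have "mean_op \<pi> (\<lambda>i. ?K (k m) h i - g i) = (\<lambda>i. - g i)"
      using mean_op_diff[of "?K (k m) h" g] h gl2 g_const mean_op_const[of "g 0"]
      by (simp add: mean_op_iterate mean_h)
    then show ?thesis
      using l2norm_mean_op[of "\<lambda>i. ?K (k m) h i - g i"] h gl2 by (simp add: l2norm_minus l2_diff)
  qed
  then have "l2norm \<pi> g \<le> 0"
    by (intro LIMSEQ_le_const[OF conv]) auto
  then have "L = 0" using norm_g[of 0] l2norm_nonneg[OF gl2] by simp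
  then show ?thesis using L by (simp add: Kh)
qed

end

section \<open>The spectral gap\<close>

text \<open>The perturbation is eventually below \<open>(1 - a) / 4\<close>, and \<open>1/4\<close> is the fixed point of the recursion
  with that constant perturbation. So \<open>d\<close> exceeds \<open>1/4\<close> by a geometrically decreasing amount only.\<close>

lemma perturbed_geometric_recursion_small:
  fixes a :: real and d e :: "nat \<Rightarrow> real"
  assumes a: "0 \<le> a" "a < 1" and e: "e \<longlonglongrightarrow> 0" and d: "\<And>m. d (Suc m) = a * d m + e m"
  obtains q where "0 < q" "d q \<le> 1/2"
proof -
  have "\<forall>\<^sub>F m in sequentially. e m < (1 - a) / 4"
    using order_tendstoD(2)[OF e, of "(1 - a) / 4"] a by simp
  then obtain m0 where m0: "\<And>m. m \<ge> m0 \<Longrightarrow> e m < (1 - a) / 4"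
    by (auto simp: eventually_sequentially)
  define p where "p = Suc m0"
  have le: "d (p + k) \<le> 1/4 + a ^ k * \<bar>d p\<bar>" for k
  proof (induction k)
    case (Suc k)
    have "d (p + Suc k) \<le> a * (1/4 + a ^ k * \<bar>d p\<bar>) + (1 - a) / 4"
      using mult_left_mono[OF Suc a(1)] m0[of "p + k"] d[of "p + k"] p_def
      unfolding add_Suc_right by linarith
    then show ?case by (simp add: algebra_simps diff_divide_distrib)
  qed simp
  have "(\<lambda>k. a ^ k * \<bar>d p\<bar>) \<longlonglongrightarrow> 0"
    by (intro tendsto_mult_left_zero LIMSEQ_realpow_zero a)
  then have "\<forall>\<^sub>F k in sequentially. a ^ k * \<bar>d p\<bar> < 1/4"
    by (rule order_tendstoD(2)) simp
  then obtain k where "a ^ k * \<bar>d p\<bar> < 1/4" by (auto simp: eventually_sequentially)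
  with le[of k] have "d (p + k) \<le> 1/2" by linarith
  then show thesis using that[of "p + k"] by (simp add: p_def)
qed

context stationary_markov
begin

text \<open>The operator \<open>P\<^sup>n - \<Pi>\<close>. Also for \<open>n = 0\<close> it satisfies the rules \<open>D\<^sub>m D\<^sub>n = D\<^sub>m\<^sub>+\<^sub>n\<close> and
  \<open>D\<^sub>n P = D\<^sub>n\<^sub>+\<^sub>1\<close>, since \<open>\<Pi> P = P \<Pi> = \<Pi>\<^sup>2 = \<Pi>\<close>.\<close>

definition deviation :: "nat \<Rightarrow> (nat \<Rightarrow> complex) \<Rightarrow> nat \<Rightarrow> complex" where
  "deviation n f = (\<lambda>i. (kernel_op P ^^ n) f i - mean_op \<pi> f i)"

lemma bounded_op_mean_op: "bounded_op \<pi> (mean_op \<pi>)"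
proof -
  have "mean_op \<pi> (\<lambda>i. f i + g i) = (\<lambda>i. mean_op \<pi> f i + mean_op \<pi> g i)"
    if "f \<in> l2 \<pi>" "g \<in> l2 \<pi>" for f g
    using mean_op_diff[OF that(1) l2_minus[OF that(2)]] mean_op_diff[OF l2_zero that(2)]
    by (simp add: mean_op_const)
  moreover have "mean_op \<pi> (\<lambda>i. c * f i) = (\<lambda>i. c * mean_op \<pi> f i)" if "f \<in> l2 \<pi>" for c f
    using suminf_mult[OF summable_norm_cancel[OF summable_weighted[OF that]], of c]
    by (simp add: mean_op_def mult.assoc)
  ultimately show ?thesis
    unfolding bounded_op_def using l2norm_mean_op by (auto intro!: exI[of _ 1])
qed

lemma deviation_in_l2 [simp]: "f \<in> l2 \<pi> \<Longrightarrow> deviation n f \<in> l2 \<pi>"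
  unfolding deviation_def by (intro l2_diff) simp_all

lemma deviation_le: "f \<in> l2 \<pi> \<Longrightarrow> l2norm \<pi> (deviation n f) \<le> 2 * l2norm \<pi> f"
  unfolding deviation_def
  using l2norm_triangle_diff[of "(kernel_op P ^^ n) f" "mean_op \<pi> f"]
    iterate_contraction[of f n] l2norm_mean_op[of f] by simp

lemma bounded_op_deviation: "bounded_op \<pi> (deviation n)"
  unfolding bounded_op_def
proof (intro conjI ballI allI)
  show "\<exists>K. \<forall>f\<in>l2 \<pi>. l2norm \<pi> (deviation n f) \<le> K * l2norm \<pi> f"
    using deviation_le by blast
qed (simp_all add: deviation_def bounded_op_add[OF bounded_op_iterate] bounded_op_add[OF bounded_op_mean_op]
      bounded_op_scale[OF bounded_op_iterate] bounded_op_scale[OF bounded_op_mean_op] l2_diff algebra_simps)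

lemma deviation_kernel_op: "f \<in> l2 \<pi> \<Longrightarrow> deviation n (kernel_op P f) = deviation (Suc n) f"
  by (simp add: deviation_def mean_op_kernel_op funpow_swap1)

lemma deviation_deviation:
  assumes f: "f \<in> l2 \<pi>"
  shows "deviation m (deviation n f) = deviation (m + n) f"
proof -
  have mm: "mean_op \<pi> (mean_op \<pi> f) = mean_op \<pi> f" "(kernel_op P ^^ m) (mean_op \<pi> f) = mean_op \<pi> f"
    by (simp_all add: mean_op_def[of \<pi> f] mean_op_const iterate_const)
  have "deviation m (deviation n f)
      = (\<lambda>i. deviation m ((kernel_op P ^^ n) f) i - deviation m (mean_op \<pi> f) i)"
    unfolding deviation_def[of n] by (rule bounded_op_diff[OF bounded_op_deviation]) (simp_all add: f)
  then show ?thesis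
    by (simp add: deviation_def mm mean_op_iterate f funpow_add)
qed

text \<open>A strict contraction up to finite rank, together with convergence on the finitely many vectors that
  span the finite-rank part, gives convergence in operator norm.\<close>

theorem spectral_gap_if_tail_contraction:
  assumes paths: "\<And>j j'. \<exists>i n. (i, j) \<in> {(i, j). 0 < P i j} ^^ n \<and> (i, j') \<in> {(i, j). 0 < P i j} ^^ n"
    and a: "0 \<le> a" "a < 1"
    and tail: "\<And>f. f \<in> l2 \<pi> \<Longrightarrow> l2norm \<pi> (\<lambda>i. if i < M then 0 else kernel_op P f i) \<le> a * l2norm \<pi> f"
  shows "spectral_gap \<pi> P"
proof -
  \<comment> \<open>Each coordinate of \<open>P f\<close> is at most \<open>\<parallel>f\<parallel> / sqrt (\<pi> j)\<close>, so \<open>e m\<close> bounds \<open>D\<^sub>m H\<close> for the rows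
    \<open>H\<close> below \<open>M\<close>.\<close>
  define e where "e m = (\<Sum>j<M. l2norm \<pi> (deviation m (unit_seq j)) / sqrt (\<pi> j))" for m
  have "e \<longlonglongrightarrow> (\<Sum>j<M. 0 / sqrt (\<pi> j))"
    unfolding e_def deviation_def
    by (intro tendsto_sum tendsto_divide tendsto_const iterates_converge_to_mean[OF paths, of _ 1])
      (auto simp: unit_seq_def weight_pos less_imp_neq[OF weight_pos, symmetric])
  then have e: "e \<longlonglongrightarrow> 0" by simp
  have step: "l2norm \<pi> (deviation (Suc m) f) \<le> (a * d + e m) * l2norm \<pi> f"
    if d: "0 \<le> d" "\<And>f. f \<in> l2 \<pi> \<Longrightarrow> l2norm \<pi> (deviation m f) \<le> d * l2norm \<pi> f" and f: "f \<in> l2 \<pi>"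
    for m d f
  proof -
    let ?T = "\<lambda>i. if i < M then 0 else kernel_op P f i"
    let ?H = "\<lambda>i. \<Sum>j<M. kernel_op P f j * unit_seq j i"
    have T: "?T \<in> l2 \<pi>" by (rule l2_mono[OF kernel_op_in_l2[OF f]]) simp
    have H: "?H \<in> l2 \<pi>" by (intro l2_sum l2_scale) simp_all
    have split: "kernel_op P f = (\<lambda>i. ?T i + ?H i)" unfolding sum_unit_seq by auto
    have "l2norm \<pi> (deviation m ?H) = l2norm \<pi> (\<lambda>i. \<Sum>j<M. kernel_op P f j * deviation m (unit_seq j) i)"
      by (subst bounded_op_sum[OF bounded_op_deviation])
        (simp_all add: l2_scale bounded_op_scale[OF bounded_op_deviation])
    also have "\<dots> \<le> (\<Sum>j<M. l2norm \<pi> (\<lambda>i. kernel_op P f j * deviation m (unit_seq j) i))"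
      by (rule l2norm_sum) (simp_all add: l2_scale)
    also have "\<dots> = (\<Sum>j<M. cmod (kernel_op P f j) * l2norm \<pi> (deviation m (unit_seq j)))"
      by (simp add: l2norm_scale)
    also have "\<dots> \<le> (\<Sum>j<M. l2norm \<pi> f / sqrt (\<pi> j) * l2norm \<pi> (deviation m (unit_seq j)))"
    proof (intro sum_mono mult_right_mono)
      fix j
      show "cmod (kernel_op P f j) \<le> l2norm \<pi> f / sqrt (\<pi> j)"
        using coordinate_le_l2norm[OF kernel_op_in_l2[OF f], of j]
          divide_right_mono[OF kernel_op_contraction[OF f], of "sqrt (\<pi> j)"] by simp
    qed simp
    also have "\<dots> = e m * l2norm \<pi> f"
      by (simp add: e_def sum_distrib_left mult.commute[of _ "l2norm \<pi> f"])
    finally have Hb: "l2norm \<pi> (deviation m ?H) \<le> e m * l2norm \<pi> f" .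
    have "l2norm \<pi> (deviation m ?T) \<le> d * (a * l2norm \<pi> f)"
      using d(2)[OF T] mult_left_mono[OF tail[OF f] d(1)] by linarith
    moreover have "deviation (Suc m) f = (\<lambda>i. deviation m ?T i + deviation m ?H i)"
      unfolding deviation_kernel_op[OF f, symmetric]
      by (subst split) (rule bounded_op_add[OF bounded_op_deviation T H])
    ultimately show ?thesis
      using l2norm_triangle[of "deviation m ?T" "deviation m ?H"] T H Hb
      by (simp add: algebra_simps)
  qed
  \<comment> \<open>The start \<open>2\<close> bounds the norm of \<open>1 - \<Pi>\<close>.\<close>
  define d where "d = rec_nat 2 (\<lambda>m x. a * x + e m)"
  have d_Suc: "d (Suc m) = a * d m + e m" for m by (simp add: d_def)
  have e_nonneg: "0 \<le> e m" for m by (auto simp: e_def intro!: sum_nonneg)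
  have d_bound: "0 \<le> d m \<and> (\<forall>f\<in>l2 \<pi>. l2norm \<pi> (deviation m f) \<le> d m * l2norm \<pi> f)" for m
  proof (induction m)
    case 0
    show ?case using deviation_le[of _ 0] by (simp add: d_def)
  next
    case (Suc m)
    then show ?case using step[of "d m" m] e_nonneg[of m] a(1) by (simp add: d_Suc)
  qed
  obtain q where q: "0 < q" "d q \<le> 1/2"
    by (rule perturbed_geometric_recursion_small[OF a e d_Suc])
  have half: "l2norm \<pi> (deviation q f) \<le> 1/2 * l2norm \<pi> f" if "f \<in> l2 \<pi>" for f
    using d_bound[of q] mult_right_mono[OF q(2), of "l2norm \<pi> f"] that by fastforce
  \<comment> \<open>Every block of \<open>q\<close> steps halves the norm; the at most \<open>q - 1\<close> remaining steps cost the factor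
    \<open>2\<close> of the trivial bound and a factor \<open>\<rho>\<^sup>-\<^sup>q = 2\<close>, hence the constant \<open>4\<close>.\<close>
  define \<rho> where "\<rho> = root q (1/2)"
  have rho: "0 < \<rho>" "\<rho> < 1" "\<rho> ^ q = 1/2"
    using q(1) by (simp_all add: \<rho>_def real_root_lt_1_iff)
  have geometric: "l2norm \<pi> (deviation n f) \<le> 4 * \<rho> ^ n * l2norm \<pi> f" if f: "f \<in> l2 \<pi>" for n f
  proof (induction n rule: less_induct)
    case (less n)
    show ?case
    proof (cases "n < q")
      case True
      then have "1/2 \<le> \<rho> ^ n"
        using power_decreasing[of n q \<rho>] rho by simp
      then have "2 * l2norm \<pi> f \<le> (4 * \<rho> ^ n) * l2norm \<pi> f"
        using f by (intro mult_right_mono) simp_all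
      then show ?thesis using deviation_le[OF f, of n] by linarith
    next
      case False
      then obtain r where r: "n = q + r" by (metis le_Suc_ex not_less)
      have "l2norm \<pi> (deviation n f) = l2norm \<pi> (deviation q (deviation r f))"
        by (simp add: r deviation_deviation f)
      also have "\<dots> \<le> 1/2 * l2norm \<pi> (deviation r f)" by (rule half) (simp add: f)
      also have "\<dots> \<le> 1/2 * (4 * \<rho> ^ r * l2norm \<pi> f)"
        using less.IH[of r] q(1) r by (intro mult_left_mono) simp_all
      also have "\<dots> = 4 * \<rho> ^ n * l2norm \<pi> f" by (simp add: r power_add rho(3))
      finally show ?thesis .
    qed
  qed
  show ?thesis
    unfolding spectral_gap_def
    using rho geometric deviation_in_l2 unfolding deviation_def
    by (intro exI[of _ \<rho>] exI[of _ 4]) auto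
qed

end

section \<open>The norm of the tail of a band kernel\<close>

context stationary_markov
begin

text \<open>The tail is the sum of the operators \<open>D m\<close> that keep one diagonal each. By the definition of the
  adjoint, \<open>P(i, j)\<^sup>2 \<pi>(i) = P(i, j) P\<^sup>*(j, i) \<pi>(j)\<close>, so a bound \<open>x m\<close> for the square root of
  \<open>P(i, i + m) P\<^sup>*(i + m, i)\<close> on the diagonal bounds the norm of \<open>D m\<close>.\<close>

lemma tail_norm_le_sum_of_diagonals:
  assumes band: "\<And>i j. i \<ge> M \<Longrightarrow> \<bar>int i - int j\<bar> > int N \<Longrightarrow> P i j = 0" and MN: "N \<le> M"
    and diag: "\<And>i m. i \<ge> M \<Longrightarrow> m \<in> {- int N..int N} \<Longrightarrow>
        sqrt (P i (nat (int i + m)) * adjoint_kernel \<pi> P (nat (int i + m)) i) \<le> x m"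
    and f: "f \<in> l2 \<pi>"
  shows "l2norm \<pi> (\<lambda>i. if i < M then 0 else kernel_op P f i) \<le> (\<Sum>m\<in>{- int N..int N}. x m) * l2norm \<pi> f"
proof -
  define D where "D m = (\<lambda>i. if i < M then 0 else
     complex_of_real (P i (nat (int i + m))) * f (nat (int i + m)))" for m
  have "section_norm n (D m) \<le> x m * l2norm \<pi> f" if m: "m \<in> {- int N..int N}" for m n
  proof -
    have x0: "0 \<le> x m"
    proof -
      have "0 \<le> sqrt (P M (nat (int M + m)) * adjoint_kernel \<pi> P (nat (int M + m)) M)"
        by (simp add: adjoint_kernel_def)
      also have "\<dots> \<le> x m" using diag[of M m] m by simp
      finally show ?thesis .
    qed
    let ?s = "\<lambda>i. nat (int i + m)"
    have entry: "(cmod (D m i))\<^sup>2 * \<pi> i \<le> (x m)\<^sup>2 * ((cmod (f (?s i)))\<^sup>2 * \<pi> (?s i))" if i: "i \<ge> M" for i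
    proof -
      have "P i (?s i) * adjoint_kernel \<pi> P (?s i) i \<le> (x m)\<^sup>2"
        using diag[OF i m] x0 by (simp add: sqrt_le_D)
      then have "(P i (?s i))\<^sup>2 * \<pi> i \<le> (x m)\<^sup>2 * \<pi> (?s i)"
        using weight_pos[of "?s i"]
        by (simp add: adjoint_kernel_def power2_eq_square field_simps)
      then have "(P i (?s i))\<^sup>2 * \<pi> i * (cmod (f (?s i)))\<^sup>2 \<le> (x m)\<^sup>2 * \<pi> (?s i) * (cmod (f (?s i)))\<^sup>2"
        by (intro mult_right_mono) simp_all
      then show ?thesis using i
        by (simp add: D_def norm_mult power_mult_distrib mult_ac)
    qed
    have "(section_norm n (D m))\<^sup>2 = (\<Sum>i\<in>{M..<n}. (cmod (D m i))\<^sup>2 * \<pi> i)"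
      unfolding section_norm_sq by (rule sum.mono_neutral_right) (auto simp: D_def)
    also have "\<dots> \<le> (\<Sum>i\<in>{M..<n}. (x m)\<^sup>2 * ((cmod (f (?s i)))\<^sup>2 * \<pi> (?s i)))"
      by (intro sum_mono entry) simp
    also have "\<dots> = (x m)\<^sup>2 * (\<Sum>i\<in>{M..<n}. (cmod (f (?s i)))\<^sup>2 * \<pi> (?s i))"
      by (simp add: sum_distrib_left)
    also have "(\<Sum>i\<in>{M..<n}. (cmod (f (?s i)))\<^sup>2 * \<pi> (?s i)) = (\<Sum>j\<in>?s ` {M..<n}. (cmod (f j))\<^sup>2 * \<pi> j)"
      using m MN by (subst sum.reindex) (auto simp: inj_on_def)
    also have "\<dots> \<le> (\<Sum>j<n + N. (cmod (f j))\<^sup>2 * \<pi> j)"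
      using m by (intro sum_mono2) auto
    also have "\<dots> = (section_norm (n + N) f)\<^sup>2" by (simp add: section_norm_sq)
    also have "(section_norm (n + N) f)\<^sup>2 \<le> (l2norm \<pi> f)\<^sup>2"
      by (intro power_mono section_norm_le f) simp
    finally have "(section_norm n (D m))\<^sup>2 \<le> (x m * l2norm \<pi> f)\<^sup>2"
      by (simp add: power_mult_distrib mult_left_mono)
    then show ?thesis by (rule power2_le_imp_le) (simp add: x0 f)
  qed
  then have D: "D m \<in> l2 \<pi>" "l2norm \<pi> (D m) \<le> x m * l2norm \<pi> f" if "m \<in> {- int N..int N}" for m
    using that by (blast intro: l2_if_sections_bounded l2norm_le_if_sections_bounded)+
  have "(\<lambda>i. if i < M then 0 else kernel_op P f i) = (\<lambda>i. \<Sum>m\<in>{- int N..int N}. D m i)"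
  proof
    fix i
    show "(if i < M then 0 else kernel_op P f i) = (\<Sum>m\<in>{- int N..int N}. D m i)"
    proof (cases "i < M")
      case False
      let ?s = "\<lambda>m. nat (int i + m)"
      let ?J = "?s ` {- int N..int N}"
      have inj: "inj_on ?s {- int N..int N}" using False MN by (auto simp: inj_on_def)
      have zero: "P i j = 0" if "j \<notin> ?J" for j
      proof (rule band)
        show "\<bar>int i - int j\<bar> > int N"
        proof (rule ccontr)
          assume "\<not> ?thesis"
          then have "j = ?s (int j - int i)" "int j - int i \<in> {- int N..int N}" by auto
          then show False using that by blast
        qed
      qed (use False in simp)
      have "kernel_op P f i = (\<Sum>j\<in>?J. complex_of_real (P i j) * f j)"
        unfolding kernel_op_def by (rule suminf_finite) (simp_all add: zero)
      also have "\<dots> = (\<Sum>m\<in>{- int N..int N}. D m i)"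
        using False by (simp add: sum.reindex[OF inj] D_def)
      finally show ?thesis using False by simp
    qed (simp add: D_def)
  qed
  then have "l2norm \<pi> (\<lambda>i. if i < M then 0 else kernel_op P f i) \<le> (\<Sum>m\<in>{- int N..int N}. l2norm \<pi> (D m))"
    using l2norm_sum[of "{- int N..int N}" D] D(1) by simp
  also have "\<dots> \<le> (\<Sum>m\<in>{- int N..int N}. x m * l2norm \<pi> f)" by (intro sum_mono D(2))
  finally show ?thesis by (simp add: sum_distrib_right)
qed

end

lemma alpha0_nonneg:
  assumes "\<And>i j. 0 \<le> P i j" "\<And>i. 0 \<le> \<pi> i"
  shows "0 \<le> alpha0 \<pi> P N"
  unfolding alpha0_def using assms
  by (intro sum_nonneg Limsup_bounded le_Limsup) (auto simp: adjoint_kernel_def intro!: le_Limsup always_eventually)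

text \<open>The room between \<open>\<alpha>\<^sub>0\<close> and \<open>a\<close> is shared equally among the \<open>2 N + 1\<close> diagonals.\<close>

lemma diagonal_bounds_if_alpha0_less:
  assumes nn: "\<And>i j. 0 \<le> P i j" "\<And>i. 0 \<le> \<pi> i" and a: "alpha0 \<pi> P N < ereal a"
  obtains x M where "M \<ge> M0" "(\<Sum>m\<in>{- int N..int N}. x m) \<le> a"
    "\<And>i m. i \<ge> M \<Longrightarrow> m \<in> {- int N..int N} \<Longrightarrow>
        sqrt (P i (nat (int i + m)) * adjoint_kernel \<pi> P (nat (int i + m)) i) \<le> x m"
proof -
  let ?I = "{- int N..int N}"
  let ?b = "\<lambda>m i. sqrt (P i (nat (int i + m)) * adjoint_kernel \<pi> P (nat (int i + m)) i)"
  define l where "l m = limsup (\<lambda>i. ereal (?b m i))" for m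
  have b0: "0 \<le> ?b m i" for m i using nn by (simp add: adjoint_kernel_def)
  have l0: "0 \<le> l m" for m
    unfolding l_def using b0 by (intro le_Limsup always_eventually) auto
  have sum_l: "(\<Sum>m\<in>?I. l m) < ereal a" using a by (simp add: alpha0_def l_def)
  have fin: "\<bar>l m\<bar> \<noteq> \<infinity>" if "m \<in> ?I" for m
  proof -
    have "l m \<le> (\<Sum>m\<in>?I. l m)" using that l0 sum_mono2[of ?I "{m}" l] by simp
    then have "l m < \<infinity>" using sum_l by (metis ereal_infty_less(1) less_ereal.simps(2) order_le_less_trans order_less_trans)
    then show ?thesis using l0[of m] by auto
  qed
  define r where "r m = real_of_ereal (l m)" for m
  have lr: "l m = ereal (r m)" if "m \<in> ?I" for m using fin[OF that] by (simp add: r_def ereal_real')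
  have "(\<Sum>m\<in>?I. l m) = ereal (\<Sum>m\<in>?I. r m)" using lr by simp
  then have sum_r: "(\<Sum>m\<in>?I. r m) < a" using sum_l by simp
  define \<delta> where "\<delta> = (a - (\<Sum>m\<in>?I. r m)) / real (card ?I)"
  have card: "0 < card ?I" by simp
  have \<delta>: "0 < \<delta>" using sum_r card unfolding \<delta>_def by (intro divide_pos_pos) auto
  define x where "x m = r m + \<delta>" for m
  have "(\<Sum>m\<in>?I. x m) = (\<Sum>m\<in>?I. r m) + real (card ?I) * \<delta>" by (simp add: x_def sum.distrib)
  also have "\<dots> = a" using card by (simp add: \<delta>_def del: card_atLeastAtMost_int)
  finally have sum_x: "(\<Sum>m\<in>?I. x m) \<le> a" by simp
  have "\<forall>\<^sub>F i in sequentially. \<forall>m\<in>?I. ?b m i \<le> x m"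
  proof (rule eventually_ball_finite)
    show "\<forall>m\<in>?I. \<forall>\<^sub>F i in sequentially. ?b m i \<le> x m"
    proof
      fix m assume "m \<in> ?I"
      then have "l m < ereal (x m)" using \<delta> by (simp add: lr x_def)
      then have "\<forall>\<^sub>F i in sequentially. ereal (?b m i) < ereal (x m)"
        unfolding l_def by (rule Limsup_lessD)
      then show "\<forall>\<^sub>F i in sequentially. ?b m i \<le> x m" by (rule eventually_mono) simp
    qed
  qed simp
  then obtain M1 where "\<And>i m. i \<ge> M1 \<Longrightarrow> m \<in> ?I \<Longrightarrow> ?b m i \<le> x m"
    unfolding eventually_sequentially by blast
  then show thesis by (intro that[of "max M0 M1" x] sum_x) auto
qed

section \<open>The spectrum of an operator with a contracting tail\<close>

lemma scalar_mat_mult_vec: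
  fixes c :: "'a :: comm_ring_1"
  assumes "v \<in> carrier_vec n"
  shows "(c \<cdot>\<^sub>m 1\<^sub>m n) *\<^sub>v v = c \<cdot>\<^sub>v v"
  using assms by (intro eq_vecI) (auto simp: scalar_prod_def if_distrib[of "\<lambda>x. _ * x"] if_distrib[of "\<lambda>x. x * _"]
      sum.delta sum.delta' cong: if_cong)

lemma holomorphic_on_det:
  fixes A :: "complex \<Rightarrow> complex mat"
  assumes A: "\<And>z. A z \<in> carrier_mat n n"
    and hol: "\<And>i j. i < n \<Longrightarrow> j < n \<Longrightarrow> (\<lambda>z. A z $$ (i, j)) holomorphic_on U"
  shows "(\<lambda>z. det (A z)) holomorphic_on U"
  unfolding det_def'[OF A]
  by (intro holomorphic_intros hol) (simp_all add: permutes_in_image)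

lemma holomorphic_on_adj_mat:
  fixes A :: "complex \<Rightarrow> complex mat"
  assumes A: "\<And>z. A z \<in> carrier_mat n n"
    and hol: "\<And>i j. i < n \<Longrightarrow> j < n \<Longrightarrow> (\<lambda>z. A z $$ (i, j)) holomorphic_on U"
    and ij: "i < n" "j < n"
  shows "(\<lambda>z. adj_mat (A z) $$ (i, j)) holomorphic_on U"
proof -
  have eq: "adj_mat (A z) $$ (i, j) = (-1) ^ (j + i) * det (mat_delete (A z) j i)" for z
    using A[of z] ij by (simp add: adj_mat_def cofactor_def)
  have dims: "dim_row (A z) = n" "dim_col (A z) = n" for z using A[of z] by auto
  have "(\<lambda>z. det (mat_delete (A z) j i)) holomorphic_on U"
  proof (rule holomorphic_on_det[where n = "n - 1"])
    show "mat_delete (A z) j i \<in> carrier_mat (n - 1) (n - 1)" for z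
      by (simp add: mat_delete_def dims)
    show "(\<lambda>z. mat_delete (A z) j i $$ (k, l)) holomorphic_on U" if "k < n - 1" "l < n - 1" for k l
      using that by (simp add: mat_delete_def dims hol)
  qed
  then show ?thesis unfolding eq by (intro holomorphic_intros)
qed

text \<open>A family indexed by a finite set may repeat vectors, whereas a spanning set may not; the
  coefficients of equal vectors are added up.\<close>

lemma finite_dimensional_if_in_span:
  fixes b :: "'b \<Rightarrow> nat \<Rightarrow> complex"
  assumes X: "finite X" and V: "\<And>g. g \<in> V \<Longrightarrow> \<exists>c. g = (\<lambda>i. \<Sum>x\<in>X. c x * b x i)"
  shows "finite_dimensional V"
  unfolding finite_dimensional_def
proof (intro exI[of _ "b ` X"] conjI ballI)
  fix g assume "g \<in> V"
  then obtain c where c: "g = (\<lambda>i. \<Sum>x\<in>X. c x * b x i)" using V by blast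
  show "\<exists>c. g = (\<lambda>i. \<Sum>b\<in>b ` X. c b * b i)"
  proof (intro exI[of _ "\<lambda>v. \<Sum>x\<in>{x \<in> X. b x = v}. c x"] ext)
    fix i
    have "g i = (\<Sum>v\<in>b ` X. \<Sum>x\<in>{x \<in> X. b x = v}. c x * b x i)"
      unfolding c by (rule sum.image_gen[OF X])
    also have "\<dots> = (\<Sum>v\<in>b ` X. (\<Sum>x\<in>{x \<in> X. b x = v}. c x) * v i)"
      unfolding sum_distrib_right by (intro sum.cong) auto
    finally show "g i = (\<Sum>v\<in>b ` X. (\<Sum>x\<in>{x \<in> X. b x = v}. c x) * v i)" .
  qed
qed (use X in simp)

lemma (in positive_weight) eigenvalue_in_spectrum:
  assumes "eigenvalue \<pi> T z"
  shows "z \<in> spectrum \<pi> T"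
  unfolding spectrum_def
proof
  assume "z \<in> resolvent_set \<pi> T"
  then obtain S where S: "bounded_op \<pi> S" and inv: "\<And>f. f \<in> l2 \<pi> \<Longrightarrow> S (\<lambda>i. z * f i - T f i) = f"
    unfolding resolvent_set_def by blast
  obtain f where f: "f \<in> l2 \<pi>" "f \<noteq> (\<lambda>_. 0)" "T f = (\<lambda>i. z * f i)"
    using assms unfolding eigenvalue_def by blast
  have "f = S (\<lambda>i. 0)" using inv[OF f(1)] f(3) by simp
  then show False using f(2) bounded_op_zero[OF S] by simp
qed

text \<open>The essential spectrum is studied for any bounded operator \<open>L\<close> whose rows from \<open>M\<close> on form an operator
  of norm at most \<open>a\<close>. The remaining rows form an operator of finite rank.\<close>

locale tail_contraction = positive_weight +
  fixes L :: "(nat \<Rightarrow> complex) \<Rightarrow> nat \<Rightarrow> complex" and M :: nat and a :: real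
  assumes bounded_L: "bounded_op \<pi> L" and a_pos: "0 < a"
    and tail_le: "f \<in> l2 \<pi> \<Longrightarrow> l2norm \<pi> (\<lambda>i. if i < M then 0 else L f i) \<le> a * l2norm \<pi> f"
begin

definition tail_op :: "(nat \<Rightarrow> complex) \<Rightarrow> nat \<Rightarrow> complex" where
  "tail_op f = (\<lambda>i. if i < M then 0 else L f i)"

lemma tail_op_in_l2: "f \<in> l2 \<pi> \<Longrightarrow> tail_op f \<in> l2 \<pi>"
  unfolding tail_op_def by (rule l2_mono[OF bounded_op_in_l2[OF bounded_L]]) auto

lemma bounded_tail_op: "bounded_op \<pi> tail_op"
  unfolding bounded_op_def
proof (intro conjI ballI allI)
  show "\<exists>K. \<forall>f\<in>l2 \<pi>. l2norm \<pi> (tail_op f) \<le> K * l2norm \<pi> f"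
    using tail_le unfolding tail_op_def by blast
qed (auto simp: tail_op_def bounded_op_add[OF bounded_L] bounded_op_scale[OF bounded_L]
      intro: tail_op_in_l2[unfolded tail_op_def])

lemmas tail_power_in_l2 = bounded_op_in_l2[OF bounded_op_funpow[OF bounded_tail_op]]

lemma tail_power_norm: "f \<in> l2 \<pi> \<Longrightarrow> l2norm \<pi> ((tail_op ^^ k) f) \<le> a ^ k * l2norm \<pi> f"
proof (induction k)
  case (Suc k)
  have "l2norm \<pi> ((tail_op ^^ Suc k) f) \<le> a * l2norm \<pi> ((tail_op ^^ k) f)"
    using tail_le[OF tail_power_in_l2[OF Suc.prems]] by (simp add: tail_op_def)
  also have "\<dots> \<le> a * (a ^ k * l2norm \<pi> f)"
    using Suc a_pos by (intro mult_left_mono) simp_all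
  finally show ?case by (simp add: mult.assoc)
qed simp

text \<open>The Neumann series of \<open>(z - T)\<^sup>-\<^sup>1\<close> for the tail \<open>T\<close>, summed in every coordinate.\<close>

definition tail_resolvent :: "complex \<Rightarrow> (nat \<Rightarrow> complex) \<Rightarrow> nat \<Rightarrow> complex" where
  "tail_resolvent z f = (\<lambda>i. \<Sum>k. (1 / z ^ Suc k) * (tail_op ^^ k) f i)"

lemma neumann_series:
  assumes S: "bounded_op \<pi> S" and z: "a < cmod z" and f: "f \<in> l2 \<pi>"
  shows "(\<lambda>k. (1 / z ^ Suc k) * S ((tail_op ^^ k) f) i) sums S (tail_resolvent z f) i"
    and tail_resolvent_in_l2: "tail_resolvent z f \<in> l2 \<pi>"
proof -
  let ?F = "\<lambda>k i. (1 / z ^ Suc k) * (tail_op ^^ k) f i"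
  let ?b = "\<lambda>k. l2norm \<pi> f / cmod z * (a / cmod z) ^ k"
  have F: "?F k \<in> l2 \<pi>" for k by (intro l2_scale tail_power_in_l2 f)
  have Fb: "l2norm \<pi> (?F k) \<le> ?b k" for k
  proof -
    have "l2norm \<pi> (?F k) = l2norm \<pi> ((tail_op ^^ k) f) / cmod z ^ Suc k"
      by (subst l2norm_scale[OF tail_power_in_l2[OF f]]) (simp add: norm_divide norm_mult norm_power)
    also have "\<dots> \<le> (a ^ k * l2norm \<pi> f) / cmod z ^ Suc k"
      by (intro divide_right_mono tail_power_norm f) simp
    finally show ?thesis by (simp add: power_divide field_simps)
  qed
  have b: "summable ?b"
    using z a_pos by (intro summable_mult summable_geometric) (simp add: divide_less_eq)
  show "tail_resolvent z f \<in> l2 \<pi>"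
    unfolding tail_resolvent_def by (rule l2_suminf[OF F Fb b])
  show "(\<lambda>k. (1 / z ^ Suc k) * S ((tail_op ^^ k) f) i) sums S (tail_resolvent z f) i"
    using bounded_op_suminf[OF S F Fb b, of i]
    unfolding tail_resolvent_def bounded_op_scale[OF S tail_power_in_l2[OF f]] .
qed

lemma bounded_op_id: "bounded_op \<pi> (\<lambda>f. f)"
  by (auto simp: bounded_op_def intro: exI[of _ 1])

lemma tail_resolvent_eq:
  assumes z: "a < cmod z" and f: "f \<in> l2 \<pi>"
  shows "z * tail_resolvent z f i - tail_op (tail_resolvent z f) i = f i"
proof -
  have z0: "z \<noteq> 0" using z a_pos by auto
  \<comment> \<open>Both terms on the left are sums of the same series, the second one without its first term.\<close>
  let ?g = "\<lambda>k. (1 / z ^ k) * (tail_op ^^ k) f i"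
  have "(\<lambda>k. z * ((1 / z ^ Suc k) * (tail_op ^^ k) f i)) sums (z * tail_resolvent z f i)"
    by (intro sums_mult neumann_series(1)[OF bounded_op_id z f])
  then have 1: "?g sums (z * tail_resolvent z f i)" using z0 by simp
  have "(\<lambda>k. ?g (Suc k)) sums tail_op (tail_resolvent z f) i"
    using neumann_series(1)[OF bounded_tail_op z f, of i] by simp
  then have "?g sums (tail_op (tail_resolvent z f) i + ?g 0)"
    by (subst (asm) sums_Suc_iff) simp
  with 1 have "z * tail_resolvent z f i = tail_op (tail_resolvent z f) i + ?g 0"
    by (rule sums_unique2)
  then show ?thesis by simp
qed

text \<open>A difference of two solutions is an eigenvector of the tail for \<open>z\<close>, which is impossible as the norm
  of the tail is below \<open>|z|\<close>.\<close>

lemma tail_resolvent_unique: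
  assumes z: "a < cmod z" and g: "g \<in> l2 \<pi>" and h: "h \<in> l2 \<pi>"
    and eq: "\<And>i. z * g i - tail_op g i = h i"
  shows "g = tail_resolvent z h"
proof -
  let ?R = "tail_resolvent z h"
  let ?d = "\<lambda>i. g i - ?R i"
  have R: "?R \<in> l2 \<pi>" by (rule tail_resolvent_in_l2[OF bounded_op_id z h])
  have d: "?d \<in> l2 \<pi>" by (rule l2_diff[OF g R])
  have "tail_op ?d = (\<lambda>i. z * ?d i)"
  proof
    fix i
    show "tail_op ?d i = z * ?d i"
      using eq[of i] tail_resolvent_eq[OF z h, of i]
      by (simp add: bounded_op_diff[OF bounded_tail_op g R] algebra_simps)
  qed
  then have "cmod z * l2norm \<pi> ?d \<le> a * l2norm \<pi> ?d"
    using tail_power_norm[OF d, of 1] l2norm_scale[OF d, of z] by simp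
  then have "(cmod z - a) * l2norm \<pi> ?d \<le> 0" by (simp add: left_diff_distrib)
  then have "l2norm \<pi> ?d \<le> 0" using z by (simp add: mult_le_0_iff)
  then have "?d = (\<lambda>i. 0)" by (rule l2norm_eq_0D[OF d])
  then show ?thesis by (auto simp: fun_eq_iff)
qed

lemma bounded_tail_resolvent:
  assumes z: "a < cmod z"
  shows "bounded_op \<pi> (tail_resolvent z)"
proof -
  let ?R = "tail_resolvent z"
  note [simp] = tail_resolvent_in_l2[OF bounded_op_id z]
  note eq = tail_resolvent_eq[OF z]
  have "?R (\<lambda>i. f i + g i) = (\<lambda>i. ?R f i + ?R g i)" if "f \<in> l2 \<pi>" "g \<in> l2 \<pi>" for f g
    using eq[OF that(1)] eq[OF that(2)] that
    by (intro tail_resolvent_unique[OF z, symmetric])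
      (simp_all add: l2_add bounded_op_add[OF bounded_tail_op] algebra_simps)
  moreover have "?R (\<lambda>i. c * f i) = (\<lambda>i. c * ?R f i)" if f: "f \<in> l2 \<pi>" for c f
  proof (intro tail_resolvent_unique[OF z, symmetric])
    fix i
    have "z * (c * ?R f i) - tail_op (\<lambda>i. c * ?R f i) i = c * (z * ?R f i - tail_op (?R f) i)"
      using f by (simp add: bounded_op_scale[OF bounded_tail_op] algebra_simps)
    then show "z * (c * ?R f i) - tail_op (\<lambda>i. c * ?R f i) i = c * f i" by (simp only: eq[OF f])
  qed (simp_all add: f l2_scale)
  moreover have "l2norm \<pi> (?R f) \<le> 1 / (cmod z - a) * l2norm \<pi> f" if f: "f \<in> l2 \<pi>" for f
  proof -
    have "(\<lambda>i. z * ?R f i) = (\<lambda>i. f i + tail_op (?R f) i)"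
      using eq[OF f] by (auto simp: algebra_simps)
    then have "cmod z * l2norm \<pi> (?R f) \<le> l2norm \<pi> f + a * l2norm \<pi> (?R f)"
      using l2norm_scale[of "?R f" z] l2norm_triangle[OF f tail_op_in_l2, of "?R f"]
        tail_power_norm[of "?R f" 1] f by simp
    then have "(cmod z - a) * l2norm \<pi> (?R f) \<le> l2norm \<pi> f" by (simp add: algebra_simps)
    then show ?thesis using z by (simp add: field_simps)
  qed
  ultimately show ?thesis
    unfolding bounded_op_def by (intro conjI ballI allI exI[of _ "1 / (cmod z - a)"]) simp_all
qed

text \<open>The Neumann series is a power series in \<open>1 / z\<close> that converges for \<open>|1 / z| < 1 / a\<close>. The operator \<open>S\<close>
  is the identity or \<open>L\<close> in the applications.\<close>

lemma holomorphic_tail_resolvent: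
  assumes S: "bounded_op \<pi> S" and f: "f \<in> l2 \<pi>"
  shows "(\<lambda>z. S (tail_resolvent z f) i) holomorphic_on {z. a < cmod z}"
proof -
  let ?c = "\<lambda>k. S ((tail_op ^^ k) f) i"
  define G where "G w = (\<Sum>k. ?c k * w ^ k)" for w
  have sums: "(\<lambda>k. ?c k * (1 / z) ^ k) sums (z * S (tail_resolvent z f) i)" if z: "a < cmod z" for z
  proof -
    have "z \<noteq> 0" using z a_pos by auto
    then show ?thesis
      using sums_mult[OF neumann_series(1)[OF S z f, of i], of z] by (simp add: power_one_over field_simps)
  qed
  have "G holomorphic_on ball 0 (1 / a)"
  proof (rule power_series_holomorphic)
    fix w :: complex assume w: "w \<in> ball 0 (1 / a)"
    have "summable (\<lambda>k. ?c k * w ^ k)"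
    proof (cases "w = 0")
      case True
      then show ?thesis by (intro summable_finite[of "{0}"]) auto
    next
      case False
      then have "a < cmod (1 / w)" using w a_pos by (simp add: norm_divide field_simps)
      then show ?thesis using sums[of "1 / w"] by (simp add: sums_iff)
    qed
    then show "(\<lambda>k. ?c k * (w - 0) ^ k) sums G w" by (simp add: G_def summable_sums)
  qed
  moreover have "(\<lambda>z. 1 / z) ` {z. a < cmod z} \<subseteq> ball 0 (1 / a)"
    using a_pos divide_strict_left_mono[of a _ 1] by (auto simp: norm_divide)
  moreover have "(\<lambda>z. 1 / z) holomorphic_on {z. a < cmod z}"
    using a_pos by (intro holomorphic_intros) auto
  ultimately have "(\<lambda>z. (1 / z) * G (1 / z)) holomorphic_on {z. a < cmod z}"
    using holomorphic_on_compose_gen[of "\<lambda>z. 1 / z" "{z. a < cmod z}" G "ball 0 (1 / a)"]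
    by (intro holomorphic_on_mult) (simp_all add: o_def)
  moreover have "(1 / z) * G (1 / z) = S (tail_resolvent z f) i" if "z \<in> {z. a < cmod z}" for z
    using sums[of z] that a_pos by (auto simp: G_def sums_iff)
  ultimately show ?thesis by (subst holomorphic_cong[OF refl]) auto
qed

text \<open>The matrix of \<open>1 - H R(z)\<close> on the span of the first \<open>M\<close> coordinate sequences, where \<open>H\<close> consists of
  the first \<open>M\<close> rows of \<open>L\<close> and \<open>R(z)\<close> is the resolvent of the tail.\<close>

definition head_matrix :: "complex \<Rightarrow> complex mat" where
  "head_matrix z = mat M M (\<lambda>(i, j). (if i = j then 1 else 0) - L (tail_resolvent z (unit_seq j)) i)"

definition head_det :: "complex \<Rightarrow> complex" where
  "head_det z = det (head_matrix z)"

definition embed_vec :: "complex vec \<Rightarrow> nat \<Rightarrow> complex" where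
  "embed_vec u = (\<lambda>i. \<Sum>j<M. u $ j * unit_seq j i)"

lemma embed_vec_in_l2 [simp]: "embed_vec u \<in> l2 \<pi>"
  unfolding embed_vec_def by (intro l2_sum l2_scale) simp_all

lemma embed_vec_apply: "embed_vec u i = (if i < M then u $ i else 0)"
  by (simp add: embed_vec_def sum_unit_seq)

lemma bounded_op_embed_vec:
  assumes S: "bounded_op \<pi> S"
  shows "S (embed_vec u) i = (\<Sum>j<M. u $ j * S (unit_seq j) i)"
  unfolding embed_vec_def
  by (subst bounded_op_sum[OF S]) (simp_all add: l2_scale bounded_op_scale[OF S])

definition head_rhs :: "complex \<Rightarrow> (nat \<Rightarrow> complex) \<Rightarrow> complex vec" where
  "head_rhs z g = vec M (\<lambda>i. L (tail_resolvent z g) i)"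

lemma head_carrier [simp]: "head_matrix z \<in> carrier_mat M M" "head_rhs z g \<in> carrier_vec M"
  by (simp_all add: head_matrix_def head_rhs_def)

lemma head_matrix_mult:
  assumes z: "a < cmod z" and u: "u \<in> carrier_vec M" and i: "i < M"
  shows "(head_matrix z *\<^sub>v u) $ i = u $ i - L (tail_resolvent z (embed_vec u)) i"
proof -
  have "tail_resolvent z (embed_vec u) = (\<lambda>i. \<Sum>j<M. u $ j * tail_resolvent z (unit_seq j) i)"
    using bounded_op_embed_vec[OF bounded_tail_resolvent[OF z]] by auto
  then have "L (tail_resolvent z (embed_vec u)) i = (\<Sum>j<M. u $ j * L (tail_resolvent z (unit_seq j)) i)"
    by (simp add: bounded_op_sum[OF bounded_L] bounded_op_scale[OF bounded_L] l2_scale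
        tail_resolvent_in_l2[OF bounded_op_id z])
  moreover have "(head_matrix z *\<^sub>v u) $ i
      = (\<Sum>j<M. ((if i = j then 1 else 0) - L (tail_resolvent z (unit_seq j)) i) * u $ j)"
    using u i by (simp add: head_matrix_def scalar_prod_def lessThan_atLeast0)
  moreover have "\<dots> = u $ i - (\<Sum>j<M. u $ j * L (tail_resolvent z (unit_seq j)) i)"
  proof -
    have "((if i = j then 1 else 0) - x) * u $ j = (if i = j then u $ j else 0) - u $ j * x" for j x
      by (simp add: algebra_simps)
    then show ?thesis using i by (simp add: sum_subtractf sum.delta')
  qed
  ultimately show ?thesis by simp
qed

lemma tail_op_plus_head: "L f i = tail_op f i + embed_vec (vec M (L f)) i"
  by (simp add: tail_op_def embed_vec_apply)

text \<open>With \<open>u = H f\<close>, the equation \<open>z f - L f = g\<close> reads \<open>z f - T f = g + u\<close>, so \<open>f = R(z) (g + u)\<close>.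
  Applying \<open>H\<close> yields \<open>u = H R(z) (g + u)\<close>, a system for the \<open>M\<close> numbers \<open>u\<close>.\<close>

lemma resolvent_equation_imp_head_system:
  assumes z: "a < cmod z" and f: "f \<in> l2 \<pi>" and g: "g \<in> l2 \<pi>" and eq: "\<And>i. z * f i - L f i = g i"
  shows "head_matrix z *\<^sub>v vec M (L f) = head_rhs z g"
    and "f = tail_resolvent z (\<lambda>i. g i + embed_vec (vec M (L f)) i)"
proof -
  let ?u = "vec M (L f)"
  show f_eq: "f = tail_resolvent z (\<lambda>i. g i + embed_vec ?u i)"
  proof (rule tail_resolvent_unique[OF z f])
    show "z * f i - tail_op f i = g i + embed_vec ?u i" for i
      using eq[of i] tail_op_plus_head[of f i] by (simp add: algebra_simps)
  qed (intro l2_add g embed_vec_in_l2)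
  have "L f = (\<lambda>i. L (tail_resolvent z g) i + L (tail_resolvent z (embed_vec ?u)) i)"
    by (subst f_eq)
      (simp add: bounded_op_add[OF bounded_tail_resolvent[OF z]] bounded_op_add[OF bounded_L] g
        tail_resolvent_in_l2[OF bounded_op_id z])
  then have "L f i - L (tail_resolvent z (embed_vec ?u)) i = L (tail_resolvent z g) i" for i
    by (simp add: fun_eq_iff)
  then show "head_matrix z *\<^sub>v ?u = head_rhs z g"
    using head_matrix_mult[OF z, of ?u]
    by (intro eq_vecI) (simp_all add: head_rhs_def head_matrix_def)
qed

text \<open>Conversely, a solution \<open>u\<close> of the system is equal to \<open>H f\<close> for the sequence \<open>f\<close> that it defines.\<close>

lemma head_system_imp_resolvent_equation:
  assumes z: "a < cmod z" and g: "g \<in> l2 \<pi>" and u: "u \<in> carrier_vec M"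
    and sys: "head_matrix z *\<^sub>v u = head_rhs z g"
  defines "f \<equiv> tail_resolvent z (\<lambda>i. g i + embed_vec u i)"
  shows "f \<in> l2 \<pi>" and "z * f i - L f i = g i"
proof -
  have gu: "(\<lambda>i. g i + embed_vec u i) \<in> l2 \<pi>" by (intro l2_add g embed_vec_in_l2)
  show "f \<in> l2 \<pi>" unfolding f_def by (rule tail_resolvent_in_l2[OF bounded_op_id z gu])
  have Lf: "L f i = L (tail_resolvent z g) i + L (tail_resolvent z (embed_vec u)) i" for i
    by (simp add: f_def bounded_op_add[OF bounded_tail_resolvent[OF z]] bounded_op_add[OF bounded_L] g
        tail_resolvent_in_l2[OF bounded_op_id z])
  have "L f i = u $ i" if "i < M" for i
  proof -
    have "(head_matrix z *\<^sub>v u) $ i = L (tail_resolvent z g) i"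
      using sys that by (simp add: head_rhs_def)
    then show ?thesis using head_matrix_mult[OF z u that] Lf[of i] by (simp add: algebra_simps)
  qed
  then have "L f i = tail_op f i + embed_vec u i"
    by (simp add: tail_op_def embed_vec_apply)
  then show "z * f i - L f i = g i"
    using tail_resolvent_eq[OF z gu, of i] by (simp add: f_def algebra_simps)
qed

text \<open>Cramer's rule. The adjugate keeps the numerator holomorphic at zeros of the determinant.\<close>

definition head_solution :: "complex \<Rightarrow> (nat \<Rightarrow> complex) \<Rightarrow> complex vec" where
  "head_solution z g = (1 / head_det z) \<cdot>\<^sub>v (adj_mat (head_matrix z) *\<^sub>v head_rhs z g)"

lemma head_system_solution:
  assumes "head_det z \<noteq> 0"
  shows "head_solution z g \<in> carrier_vec M"
    and "head_matrix z *\<^sub>v head_solution z g = head_rhs z g"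
    and "u \<in> carrier_vec M \<Longrightarrow> head_matrix z *\<^sub>v u = head_rhs z g \<Longrightarrow> u = head_solution z g"
proof -
  note adj = adj_mat[OF head_carrier(1)[of z]]
  show c: "head_solution z g \<in> carrier_vec M"
    unfolding head_solution_def using adj(1) by (auto intro!: carrier_vecI)
  have "head_matrix z *\<^sub>v head_solution z g
      = (1 / head_det z) \<cdot>\<^sub>v ((head_matrix z * adj_mat (head_matrix z)) *\<^sub>v head_rhs z g)"
    unfolding head_solution_def
    using adj(1) by (subst mult_mat_vec[of _ M M]) (auto simp: assoc_mult_mat_vec[of _ M M _ M])
  also have "\<dots> = head_rhs z g"
    using assms by (auto simp: adj(2) scalar_mat_mult_vec[of _ M] smult_smult_assoc head_det_def)
  finally show "head_matrix z *\<^sub>v head_solution z g = head_rhs z g" .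
  show "u = head_solution z g" if u: "u \<in> carrier_vec M" "head_matrix z *\<^sub>v u = head_rhs z g"
  proof -
    have "head_solution z g = (1 / head_det z) \<cdot>\<^sub>v ((adj_mat (head_matrix z) * head_matrix z) *\<^sub>v u)"
      unfolding head_solution_def u(2)[symmetric]
      using adj(1) u(1) by (simp add: assoc_mult_mat_vec[of _ M M _ M])
    also have "\<dots> = u"
      using assms u(1) by (auto simp: adj(3) scalar_mat_mult_vec[of _ M] smult_smult_assoc head_det_def)
    finally show ?thesis by simp
  qed
qed

lemma head_solution_entry:
  assumes j: "j < M"
  shows "head_solution z g $ j
    = (\<Sum>k<M. adj_mat (head_matrix z) $$ (j, k) * L (tail_resolvent z g) k) / head_det z"
  using j adj_mat(1)[OF head_carrier(1)[of z]]
  by (simp add: head_solution_def head_rhs_def scalar_prod_def lessThan_atLeast0)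

definition full_resolvent :: "complex \<Rightarrow> (nat \<Rightarrow> complex) \<Rightarrow> nat \<Rightarrow> complex" where
  "full_resolvent z g = tail_resolvent z (\<lambda>i. g i + embed_vec (head_solution z g) i)"

lemma full_resolvent:
  assumes z: "a < cmod z" and d: "head_det z \<noteq> 0" and g: "g \<in> l2 \<pi>"
  shows full_resolvent_in_l2: "full_resolvent z g \<in> l2 \<pi>"
    and full_resolvent_eq: "z * full_resolvent z g i - L (full_resolvent z g) i = g i"
    and full_resolvent_unique:
      "f \<in> l2 \<pi> \<Longrightarrow> (\<And>i. z * f i - L f i = g i) \<Longrightarrow> f = full_resolvent z g"
proof -
  note sol = head_system_solution(1,2)[OF d, of g]
  show "full_resolvent z g \<in> l2 \<pi>"
    unfolding full_resolvent_def by (rule head_system_imp_resolvent_equation(1)[OF z g sol])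
  show "z * full_resolvent z g i - L (full_resolvent z g) i = g i"
    unfolding full_resolvent_def by (rule head_system_imp_resolvent_equation(2)[OF z g sol])
  show "f = full_resolvent z g" if "f \<in> l2 \<pi>" "\<And>i. z * f i - L f i = g i"
    using resolvent_equation_imp_head_system[OF z that(1) g that(2)]
      head_system_solution(3)[OF d, of "vec M (L f)" g]
    by (simp add: full_resolvent_def)
qed

lemma resolvent_eq_full_resolvent:
  assumes z: "a < cmod z" and d: "head_det z \<noteq> 0" and g: "g \<in> l2 \<pi>"
  shows "resolvent \<pi> L z g = full_resolvent z g"
  unfolding resolvent_def
proof (rule the_equality)
  show "full_resolvent z g \<in> l2 \<pi> \<and> (\<lambda>i. z * full_resolvent z g i - L (full_resolvent z g) i) = g"
    by (simp add: full_resolvent_in_l2[OF z d g] full_resolvent_eq[OF z d g])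
  show "h = full_resolvent z g" if "h \<in> l2 \<pi> \<and> (\<lambda>i. z * h i - L h i) = g" for h
    using that by (intro full_resolvent_unique[OF z d g]) auto
qed

text \<open>Linearity follows from the uniqueness of solutions, and the norm bound from Cramer's rule, whose
  right-hand sides are continuous in \<open>g\<close>.\<close>

lemma bounded_full_resolvent:
  assumes z: "a < cmod z" and d: "head_det z \<noteq> 0"
  shows "bounded_op \<pi> (full_resolvent z)"
proof -
  let ?S = "full_resolvent z"
  note [simp] = full_resolvent_in_l2[OF z d]
  note eq = full_resolvent_eq[OF z d]
  have add: "?S (\<lambda>i. f i + g i) = (\<lambda>i. ?S f i + ?S g i)" if "f \<in> l2 \<pi>" "g \<in> l2 \<pi>" for f g
    using eq[OF that(1)] eq[OF that(2)] that
    by (intro full_resolvent_unique[OF z d, symmetric])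
      (simp_all add: l2_add bounded_op_add[OF bounded_L] algebra_simps)
  have scale: "?S (\<lambda>i. c * f i) = (\<lambda>i. c * ?S f i)" if f: "f \<in> l2 \<pi>" for c f
  proof (intro full_resolvent_unique[OF z d, symmetric])
    fix i
    have "z * (c * ?S f i) - L (\<lambda>i. c * ?S f i) i = c * (z * ?S f i - L (?S f) i)"
      using f by (simp add: bounded_op_scale[OF bounded_L] algebra_simps)
    then show "z * (c * ?S f i) - L (\<lambda>i. c * ?S f i) i = c * f i" by (simp only: eq[OF f])
  qed (simp_all add: f l2_scale)
  obtain K where K: "0 < K" "\<And>f. f \<in> l2 \<pi> \<Longrightarrow> l2norm \<pi> (tail_resolvent z f) \<le> K * l2norm \<pi> f"
    by (rule bounded_opE[OF bounded_tail_resolvent[OF z]]) auto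
  have "\<forall>k. \<exists>C. \<forall>f\<in>l2 \<pi>. cmod (L f k) \<le> C * l2norm \<pi> f \<and> 0 < C"
    by (metis bounded_op_coordinate_bound[OF bounded_L])
  then obtain C where C: "\<And>k f. f \<in> l2 \<pi> \<Longrightarrow> cmod (L f k) \<le> C k * l2norm \<pi> f"
    and C0: "\<And>k. 0 < C k"
    using l2_zero by metis
  let ?A = "\<lambda>j k. adj_mat (head_matrix z) $$ (j, k)"
  define c where "c j = (\<Sum>k<M. cmod (?A j k) * (C k * K)) / cmod (head_det z)" for j
  have cb: "cmod (head_solution z g $ j) \<le> c j * l2norm \<pi> g" if j: "j < M" and g: "g \<in> l2 \<pi>" for j g
  proof -
    have "cmod (\<Sum>k<M. ?A j k * L (tail_resolvent z g) k)
        \<le> (\<Sum>k<M. cmod (?A j k) * (C k * (K * l2norm \<pi> g)))"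
    proof (intro order_trans[OF norm_sum] sum_mono)
      fix k
      have "cmod (L (tail_resolvent z g) k) \<le> C k * l2norm \<pi> (tail_resolvent z g)"
        by (rule C[OF tail_resolvent_in_l2[OF bounded_op_id z g]])
      also have "\<dots> \<le> C k * (K * l2norm \<pi> g)"
        using K(2)[OF g] C0[of k] by (intro mult_left_mono) simp_all
      finally show "cmod (?A j k * L (tail_resolvent z g) k) \<le> cmod (?A j k) * (C k * (K * l2norm \<pi> g))"
        by (simp add: norm_mult mult_left_mono)
    qed
    also have "\<dots> = (\<Sum>k<M. cmod (?A j k) * (C k * K)) * l2norm \<pi> g"
      by (simp add: sum_distrib_right mult.assoc)
    finally have "cmod (\<Sum>k<M. ?A j k * L (tail_resolvent z g) k) / cmod (head_det z)
        \<le> (\<Sum>k<M. cmod (?A j k) * (C k * K)) * l2norm \<pi> g / cmod (head_det z)"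
      by (rule divide_right_mono) simp
    then show ?thesis by (simp add: head_solution_entry[OF j] norm_divide c_def)
  qed
  let ?B = "K * (1 + (\<Sum>j<M. c j * l2norm \<pi> (unit_seq j)))"
  have "l2norm \<pi> (?S g) \<le> ?B * l2norm \<pi> g" if g: "g \<in> l2 \<pi>" for g
  proof -
    let ?u = "head_solution z g"
    have "l2norm \<pi> (embed_vec ?u) \<le> (\<Sum>j<M. l2norm \<pi> (\<lambda>i. ?u $ j * unit_seq j i))"
      unfolding embed_vec_def by (rule l2norm_sum) (simp_all add: l2_scale)
    also have "\<dots> = (\<Sum>j<M. cmod (?u $ j) * l2norm \<pi> (unit_seq j))" by (simp add: l2norm_scale)
    also have "\<dots> \<le> (\<Sum>j<M. (c j * l2norm \<pi> g) * l2norm \<pi> (unit_seq j))"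
      by (intro sum_mono mult_right_mono cb g) simp_all
    finally have "l2norm \<pi> (embed_vec ?u) \<le> (\<Sum>j<M. c j * l2norm \<pi> (unit_seq j)) * l2norm \<pi> g"
      by (simp add: sum_distrib_left mult_ac)
    then have "l2norm \<pi> (\<lambda>i. g i + embed_vec ?u i)
        \<le> (1 + (\<Sum>j<M. c j * l2norm \<pi> (unit_seq j))) * l2norm \<pi> g"
      using l2norm_triangle[OF g embed_vec_in_l2, of ?u] by (simp add: distrib_right)
    then have "K * l2norm \<pi> (\<lambda>i. g i + embed_vec ?u i)
        \<le> K * ((1 + (\<Sum>j<M. c j * l2norm \<pi> (unit_seq j))) * l2norm \<pi> g)"
      using K(1) by (intro mult_left_mono) simp_all
    then show ?thesis
      using K(2)[OF l2_add[OF g embed_vec_in_l2], of ?u] by (simp add: full_resolvent_def mult.assoc)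
  qed
  then have "\<exists>K. \<forall>f\<in>l2 \<pi>. l2norm \<pi> (?S f) \<le> K * l2norm \<pi> f" by blast
  then show ?thesis
    unfolding bounded_op_def using add scale by (intro conjI ballI allI) simp_all
qed

lemma head_det_nonzero_imp_resolvent_set:
  assumes z: "a < cmod z" and d: "head_det z \<noteq> 0"
  shows "z \<in> resolvent_set \<pi> L"
proof -
  have "full_resolvent z (\<lambda>i. z * f i - L f i) = f" if f: "f \<in> l2 \<pi>" for f
    by (rule full_resolvent_unique[OF z d, symmetric])
      (simp_all add: f l2_diff l2_scale bounded_op_in_l2[OF bounded_L])
  then show ?thesis
    unfolding resolvent_set_def using bounded_full_resolvent[OF z d] full_resolvent_eq[OF z d] by blast
qed

lemma head_det_zero_imp_eigenvalue:
  assumes z: "a < cmod z" and d: "head_det z = 0"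
  shows "eigenvalue \<pi> L z"
proof -
  obtain u where u: "u \<in> carrier_vec M" "u \<noteq> 0\<^sub>v M" "head_matrix z *\<^sub>v u = 0\<^sub>v M"
    using d det_0_iff_vec_prod_zero[OF head_carrier(1)] by (auto simp: head_det_def)
  have "head_rhs z (\<lambda>i. 0) = 0\<^sub>v M"
    by (intro eq_vecI)
      (simp_all add: head_rhs_def bounded_op_zero[OF bounded_tail_resolvent[OF z]] bounded_op_zero[OF bounded_L])
  then have sys: "head_matrix z *\<^sub>v u = head_rhs z (\<lambda>i. 0)" using u(3) by simp
  define f where "f = tail_resolvent z (\<lambda>i. 0 + embed_vec u i)"
  note f = head_system_imp_resolvent_equation[OF z l2_zero u(1) sys, folded f_def]
  have "f \<noteq> (\<lambda>_. 0)"
  proof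
    assume f0: "f = (\<lambda>_. 0)"
    have "embed_vec u i = 0" for i
      using tail_resolvent_eq[OF z embed_vec_in_l2, of u i] f0
      by (simp add: f_def bounded_op_zero[OF bounded_tail_op])
    then have "u $ i = 0" if "i < M" for i using that by (metis embed_vec_apply)
    then show False using u(1,2) by (auto intro: eq_vecI)
  qed
  moreover have "L f = (\<lambda>i. z * f i)" using f(2) by (auto simp: fun_eq_iff)
  ultimately show ?thesis using f(1) unfolding eigenvalue_def by blast
qed

lemma spectrum_iff_head_det:
  "a < cmod z \<Longrightarrow> z \<in> spectrum \<pi> L \<longleftrightarrow> head_det z = 0"
  using head_det_nonzero_imp_resolvent_set[of z] eigenvalue_in_spectrum[OF head_det_zero_imp_eigenvalue, of z]
  by (auto simp: spectrum_def)

abbreviation outer_region :: "complex set" where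
  "outer_region \<equiv> {z. a < cmod z}"

lemma open_outer_region: "open outer_region"
  by (rule open_Collect_less) (intro continuous_intros)+

lemma connected_outer_region: "connected outer_region"
proof -
  have "outer_region = - cball 0 a" by auto
  then show ?thesis
    using connected_complement_bounded_convex[of "cball 0 a :: complex set"] by simp
qed

lemma head_matrix_holomorphic:
  "i < M \<Longrightarrow> j < M \<Longrightarrow> (\<lambda>z. head_matrix z $$ (i, j)) holomorphic_on outer_region"
  unfolding head_matrix_def
  by (auto intro!: holomorphic_intros holomorphic_tail_resolvent[OF bounded_L])

lemma head_det_holomorphic: "head_det holomorphic_on outer_region"
  using holomorphic_on_det[OF head_carrier(1) head_matrix_holomorphic]
  by (simp add: head_det_def[abs_def])

text \<open>Every zero of the determinant is an eigenvalue, and eigenvalues are bounded by the operator norm.\<close>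

lemma head_det_nonzero_somewhere: "\<exists>z\<in>outer_region. head_det z \<noteq> 0"
proof -
  obtain K where K: "0 < K" "\<And>f. f \<in> l2 \<pi> \<Longrightarrow> l2norm \<pi> (L f) \<le> K * l2norm \<pi> f"
    by (rule bounded_opE[OF bounded_L]) auto
  \<comment> \<open>A point outside both the disc of radius \<open>a\<close> and the disc given by the operator norm.\<close>
  define z where "z = complex_of_real (max K a + 1)"
  have z: "K < cmod z" "a < cmod z" using K(1) unfolding z_def norm_of_real by auto
  have "head_det z \<noteq> 0"
  proof
    assume "head_det z = 0"
    then obtain f where f: "f \<in> l2 \<pi>" "f \<noteq> (\<lambda>_. 0)" "L f = (\<lambda>i. z * f i)"
      using head_det_zero_imp_eigenvalue[OF z(2)] unfolding eigenvalue_def by blast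
    have "cmod z * l2norm \<pi> f \<le> K * l2norm \<pi> f"
      using K(2)[OF f(1)] f(3) l2norm_scale[OF f(1), of z] by simp
    then have "(cmod z - K) * l2norm \<pi> f \<le> 0" by (simp add: left_diff_distrib)
    then have "l2norm \<pi> f \<le> 0" using z(1) by (simp add: mult_le_0_iff)
    then show False using l2norm_eq_0D[OF f(1)] f(2) by simp
  qed
  then show ?thesis using z(2) by blast
qed

lemma head_det_factorization:
  assumes z: "a < cmod z" and d: "head_det z = 0"
  obtains q r p where "0 < p" "0 < r" "ball z r \<subseteq> outer_region" "q holomorphic_on ball z r"
    "\<And>w. w \<in> ball z r \<Longrightarrow> head_det w = (w - z) ^ p * q w" "\<And>w. w \<in> ball z r \<Longrightarrow> q w \<noteq> 0"
proof -
  obtain w where w: "w \<in> outer_region" "head_det w \<noteq> 0" using head_det_nonzero_somewhere by blast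
  have zr: "z \<in> outer_region" using z by simp
  have "\<not> head_det constant_on outer_region"
  proof
    assume "head_det constant_on outer_region"
    then have "head_det w = head_det z" using w(1) zr unfolding constant_on_def by metis
    then show False using w(2) d by simp
  qed
  then show thesis
    by (rule holomorphic_factor_zero_nonconstant[OF head_det_holomorphic open_outer_region
          connected_outer_region zr d]) (rule that)
qed

text \<open>Near a zero \<open>z\<close> of order \<open>p\<close> of the determinant, the resolvent of \<open>L\<close> is \<open>R(w) f\<close>, which is
  holomorphic, plus \<open>\<Sum>j<M. H\<^sub>j(w) R(w) e\<^sub>j / (w - z)\<^sup>p\<close> with holomorphic scalars \<open>H\<^sub>j\<close> that depend on \<open>f\<close>.
  Cauchy's formula for the derivative of order \<open>p - 1\<close> and the Leibniz rule express the Riesz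
  projection by the derivatives of order below \<open>p\<close> of \<open>R(w) e\<^sub>j\<close> at \<open>z\<close>, which do not depend on \<open>f\<close>.\<close>

theorem spectral_value_outside_disc:
  assumes spec: "z \<in> spectrum \<pi> L" and z: "a < cmod z"
  shows "z isolated_in spectrum \<pi> L" "eigenvalue \<pi> L z" "finite_algebraic_multiplicity \<pi> L z"
proof -
  have d: "head_det z = 0" using spec spectrum_iff_head_det[OF z] by simp
  show "eigenvalue \<pi> L z" by (rule head_det_zero_imp_eigenvalue[OF z d])
  obtain q r p where p: "0 < p" and r: "0 < r" and sub: "ball z r \<subseteq> outer_region"
    and q: "q holomorphic_on ball z r"
    and fact: "\<And>w. w \<in> ball z r \<Longrightarrow> head_det w = (w - z) ^ p * q w"
    and q0: "\<And>w. w \<in> ball z r \<Longrightarrow> q w \<noteq> 0"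
    by (rule head_det_factorization[OF z d]) (rule that)
  have spec_ball: "w \<in> spectrum \<pi> L \<longleftrightarrow> w = z" if w: "w \<in> ball z r" for w
  proof -
    have "a < cmod w" using w sub by blast
    then have "w \<in> spectrum \<pi> L \<longleftrightarrow> (w - z) ^ p * q w = 0"
      using spectrum_iff_head_det[of w] fact[OF w] by simp
    then show ?thesis using q0[OF w] p by simp
  qed
  show "z isolated_in spectrum \<pi> L"
    unfolding isolated_in_def
  proof (intro conjI exI)
    show "ball z r \<inter> spectrum \<pi> L = {z}" using spec spec_ball centre_in_ball[of z r] r by blast
  qed (use spec in simp_all)
  define e where "e = r / 2"
  have e: "0 < e" "cball z e \<subseteq> ball z r" using r by (auto simp: e_def)
  have spec_e: "spectrum \<pi> L \<inter> cball z e = {z}"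
    using spec spec_ball e(2) centre_in_cball[of z e] e(1) less_imp_le by blast
  define b where "b = (\<lambda>(j, k). \<lambda>i. (deriv ^^ k) (\<lambda>w. tail_resolvent w (unit_seq j) i) z)"
  let ?X = "{..<M} \<times> {..<p}"
  have "finite_dimensional (riesz_projection \<pi> L z e ` l2 \<pi>)"
  proof (rule finite_dimensional_if_in_span[where X = ?X and b = b])
    show "finite ?X" by simp
    fix g assume "g \<in> riesz_projection \<pi> L z e ` l2 \<pi>"
    then obtain f where f: "f \<in> l2 \<pi>" and g: "g = riesz_projection \<pi> L z e f" by blast
    define H where "H j w = (\<Sum>k<M. adj_mat (head_matrix w) $$ (j, k) * L (tail_resolvent w f) k) / q w" for j w
    have holR: "(\<lambda>w. tail_resolvent w h i) holomorphic_on ball z r" if "h \<in> l2 \<pi>" for h i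
      using holomorphic_on_subset[OF holomorphic_tail_resolvent[OF bounded_op_id that] sub] .
    have holH: "H j holomorphic_on ball z r" if j: "j < M" for j
      unfolding H_def
    proof (intro holomorphic_on_divide holomorphic_on_sum holomorphic_on_mult)
      show "(\<lambda>w. adj_mat (head_matrix w) $$ (j, k)) holomorphic_on ball z r" if "k \<in> {..<M}" for k
        by (rule holomorphic_on_subset[OF holomorphic_on_adj_mat[OF head_carrier(1) head_matrix_holomorphic] sub])
          (use j that in simp_all)
      show "(\<lambda>w. L (tail_resolvent w f) k) holomorphic_on ball z r" for k
        by (rule holomorphic_on_subset[OF holomorphic_tail_resolvent[OF bounded_L f] sub])
    qed (use q q0 in simp_all)
    have res: "resolvent \<pi> L w f i = tail_resolvent w f i
        + (\<Sum>j<M. tail_resolvent w (unit_seq j) i * H j w / (w - z) ^ Suc (p - 1))"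
      if w: "w \<in> sphere z e" for w i
    proof -
      have wb: "w \<in> ball z r" and wz: "w \<noteq> z" using w e by auto
      have wa: "a < cmod w" using wb sub by auto
      have dw: "head_det w \<noteq> 0" using fact[OF wb] q0[OF wb] wz by simp
      have "resolvent \<pi> L w f i = tail_resolvent w f i + tail_resolvent w (embed_vec (head_solution w f)) i"
        unfolding resolvent_eq_full_resolvent[OF wa dw f] full_resolvent_def
        by (simp add: bounded_op_add[OF bounded_tail_resolvent[OF wa] f])
      also have "tail_resolvent w (embed_vec (head_solution w f)) i
          = (\<Sum>j<M. head_solution w f $ j * tail_resolvent w (unit_seq j) i)"
        by (rule bounded_op_embed_vec[OF bounded_tail_resolvent[OF wa]])
      also have "\<dots> = (\<Sum>j<M. tail_resolvent w (unit_seq j) i * H j w / (w - z) ^ Suc (p - 1))"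
        using p by (intro sum.cong) (simp_all add: head_solution_entry H_def fact[OF wb] mult.commute)
      finally show ?thesis .
    qed
    define c where "c = (\<lambda>(j, k). of_nat ((p - 1) choose k) * (deriv ^^ (p - 1 - k)) (H j) z / fact (p - 1))"
    have "g i = (\<Sum>x\<in>?X. c x * b x i)" for i
    proof -
      let ?R = "\<lambda>j w. tail_resolvent w (unit_seq j) i"
      let ?D = "\<lambda>j. (deriv ^^ (p - 1)) (\<lambda>w. ?R j w * H j w) z"
      have int1: "((\<lambda>w. tail_resolvent w f i) has_contour_integral 0) (circlepath z e)"
        using e by (intro Cauchy_theorem_convex_simple[of _ "ball z r"] holR f) auto
      have "((\<lambda>w. ?R j w * H j w / (w - z) ^ Suc (p - 1)) has_contour_integral
          (2 * pi * \<i>) / fact (p - 1) * ?D j) (circlepath z e)" if "j < M" for j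
      proof (rule Cauchy_has_contour_integral_higher_derivative_circlepath)
        have hol: "(\<lambda>w. ?R j w * H j w) holomorphic_on ball z r"
          by (intro holomorphic_on_mult holR holH that) simp
        show "continuous_on (cball z e) (\<lambda>w. ?R j w * H j w)"
          by (rule holomorphic_on_imp_continuous_on[OF holomorphic_on_subset[OF hol e(2)]])
        show "(\<lambda>w. ?R j w * H j w) holomorphic_on ball z e"
          using e(2) ball_subset_cball by (intro holomorphic_on_subset[OF hol]) blast
      qed (use e(1) in simp)
      then have int2: "((\<lambda>w. \<Sum>j<M. ?R j w * H j w / (w - z) ^ Suc (p - 1)) has_contour_integral
          (\<Sum>j<M. (2 * pi * \<i>) / fact (p - 1) * ?D j)) (circlepath z e)"
        by (intro has_contour_integral_sum) auto
      have "((\<lambda>w. resolvent \<pi> L w f i) has_contour_integral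
          (0 + (\<Sum>j<M. (2 * pi * \<i>) / fact (p - 1) * ?D j))) (circlepath z e)"
        by (rule has_contour_integral_eq[OF has_contour_integral_add[OF int1 int2]])
          (use e(1) res in \<open>simp add: less_imp_le\<close>)
      then have "g i = 1 / (2 * pi * \<i>) * (\<Sum>j<M. (2 * pi * \<i>) / fact (p - 1) * ?D j)"
        unfolding g riesz_projection_def by (simp add: contour_integral_unique)
      also have "\<dots> = (\<Sum>j<M. ?D j / fact (p - 1))"
        by (simp add: sum_distrib_left)
      also have "\<dots> = (\<Sum>j<M. \<Sum>k<p. c (j, k) * b (j, k) i)"
      proof (rule sum.cong[OF refl])
        fix j assume "j \<in> {..<M}"
        then have "?D j = (\<Sum>k=0..p - 1. of_nat ((p - 1) choose k) * (deriv ^^ k) (?R j) z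
            * (deriv ^^ (p - 1 - k)) (H j) z)"
          using r by (intro higher_deriv_mult[of _ "ball z r"] holR holH) simp_all
        moreover have "{0..p - 1} = {..<p}" using p by auto
        ultimately show "?D j / fact (p - 1) = (\<Sum>k<p. c (j, k) * b (j, k) i)"
          by (simp add: c_def b_def sum_divide_distrib mult_ac)
      qed
      finally show ?thesis by (simp add: sum.cartesian_product)
    qed
    then have "g = (\<lambda>i. \<Sum>x\<in>?X. c x * b x i)" by (rule ext)
    then show "\<exists>c. g = (\<lambda>i. \<Sum>x\<in>?X. c x * b x i)" by blast
  qed
  then show "finite_algebraic_multiplicity \<pi> L z"
    unfolding finite_algebraic_multiplicity_def using e(1) spec_e by blast
qed

end

section \<open>The band kernel\<close>

text \<open>The radius \<open>a\<close> itself satisfies the condition in the definition of the infimum.\<close>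

corollary (in tail_contraction) ess_spectral_radius_le: "ess_spectral_radius \<pi> L \<le> ereal a"
  unfolding ess_spectral_radius_def
  by (rule Inf_lower) (use a_pos spectral_value_outside_disc in auto)

theorem theorem1:
  fixes P :: "nat \<Rightarrow> nat \<Rightarrow> real" and \<pi> :: "nat \<Rightarrow> real" and i0 N :: nat
  assumes "markov_kernel P"
    and "irreducible_kernel P"
    and "aperiodic_kernel P"
    and "invariant_probability P \<pi>"
    and "\<And>\<nu>. invariant_probability P \<nu> \<Longrightarrow> \<nu> = \<pi>"
    and "N \<ge> 1"
    and "\<And>i j. i \<ge> i0 \<Longrightarrow> \<bar>int i - int j\<bar> > int N \<Longrightarrow> P i j = 0"
    and "alpha0 \<pi> P N < 1"
  shows "spectral_gap \<pi> P \<and> ess_spectral_radius \<pi> (kernel_op P) \<le> alpha0 \<pi> P N"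
proof -
  have P0: "0 \<le> P i j" and P1: "P i sums 1" for i j
    using assms(1) by (auto simp: markov_kernel_def)
  have pi0: "0 \<le> \<pi> i" and pi1: "\<pi> sums 1" and inv: "(\<lambda>i. \<pi> i * P i j) sums \<pi> j" for i j
    using assms(4) by (auto simp: invariant_probability_def)
  \<comment> \<open>Mass at some state is carried along a path to every other state.\<close>
  have "0 < \<pi> j" for j
  proof -
    have "\<exists>k. \<pi> k \<noteq> 0"
    proof (rule ccontr)
      assume "\<not> ?thesis"
      then have "\<pi> = (\<lambda>_. 0)" by auto
      then show False using pi1 sums_unique2[of \<pi> 0 1] by simp
    qed
    then obtain k where k: "0 < \<pi> k" using pi0 by (metis less_le)
    obtain n where "(k, j) \<in> {(i, j). 0 < P i j} ^^ n"
      using assms(2) kernel_power_pos_imp_path[OF assms(1)] unfolding irreducible_kernel_def by blast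
    then show ?thesis
    proof (induction n arbitrary: j)
      case (Suc n)
      then obtain l where l: "(k, l) \<in> {(i, j). 0 < P i j} ^^ n" "0 < P l j" by auto
      have "0 < \<pi> l * P l j" using Suc.IH[OF l(1)] l(2) by simp
      also have "\<dots> \<le> \<pi> j"
        using sum_le_suminf[of "\<lambda>i. \<pi> i * P i j" "{l}"] inv[of j] P0 pi0 by (simp add: sums_iff)
      finally show ?case .
    qed (use k in simp)
  qed
  then interpret stationary_markov \<pi> P
    by unfold_locales (use pi1 P0 P1 inv in auto)
  have tail: "\<exists>M. \<forall>f\<in>l2 \<pi>. l2norm \<pi> (\<lambda>i. if i < M then 0 else kernel_op P f i) \<le> a * l2norm \<pi> f"
    if a: "alpha0 \<pi> P N < ereal a" for a
  proof -
    obtain x M where M: "M \<ge> max i0 N" and x: "(\<Sum>m\<in>{- int N..int N}. x m) \<le> a"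
      and diag: "\<And>i m. i \<ge> M \<Longrightarrow> m \<in> {- int N..int N} \<Longrightarrow>
        sqrt (P i (nat (int i + m)) * adjoint_kernel \<pi> P (nat (int i + m)) i) \<le> x m"
      by (rule diagonal_bounds_if_alpha0_less[of P \<pi> N a "max i0 N", OF P0 pi0 a]) (rule that)
    have "l2norm \<pi> (\<lambda>i. if i < M then 0 else kernel_op P f i) \<le> a * l2norm \<pi> f" if f: "f \<in> l2 \<pi>" for f
    proof -
      have "l2norm \<pi> (\<lambda>i. if i < M then 0 else kernel_op P f i)
          \<le> (\<Sum>m\<in>{- int N..int N}. x m) * l2norm \<pi> f"
        using M by (intro tail_norm_le_sum_of_diagonals assms(7) diag f) auto
      also have "\<dots> \<le> a * l2norm \<pi> f" using f by (intro mult_right_mono x) simp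
      finally show ?thesis .
    qed
    then show ?thesis by blast
  qed
  have alpha_nonneg: "0 \<le> alpha0 \<pi> P N" by (rule alpha0_nonneg[OF P0 pi0])
  have "spectral_gap \<pi> P"
  proof -
    obtain a where a: "alpha0 \<pi> P N < ereal a" "ereal a < 1"
      using ereal_dense2[OF assms(8)] by blast
    obtain M where "\<And>f. f \<in> l2 \<pi> \<Longrightarrow> l2norm \<pi> (\<lambda>i. if i < M then 0 else kernel_op P f i) \<le> a * l2norm \<pi> f"
      using tail[OF a(1)] by blast
    moreover have "0 \<le> a" "a < 1"
      using a(2) order_le_less_trans[OF alpha_nonneg a(1)] by simp_all
    ultimately show ?thesis
      using spectral_gap_if_tail_contraction[OF equal_length_paths[OF assms(1-3)]] by blast
  qed
  moreover have "ess_spectral_radius \<pi> (kernel_op P) \<le> alpha0 \<pi> P N"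
  proof (rule dense_ge)
    fix y assume y: "alpha0 \<pi> P N < y"
    then obtain a where a: "alpha0 \<pi> P N < ereal a" "ereal a < y"
      using ereal_dense2 by blast
    obtain M where M: "\<And>f. f \<in> l2 \<pi> \<Longrightarrow> l2norm \<pi> (\<lambda>i. if i < M then 0 else kernel_op P f i) \<le> a * l2norm \<pi> f"
      using tail[OF a(1)] by blast
    have "0 < a" using order_le_less_trans[OF alpha_nonneg a(1)] by simp
    then interpret tail_contraction \<pi> "kernel_op P" M a
      by unfold_locales (use bounded_op_kernel_op M in auto)
    show "ess_spectral_radius \<pi> (kernel_op P) \<le> y"
      using ess_spectral_radius_le a(2) by simp
  qed
  ultimately show ?thesis ..
qed

end
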